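(* Assume that $\mu \colon \mathcal{P}^2_o \to \mathbb{R}^{2\times 2}$ is a measurable valuation which is $\mathrm{GL}(2)$-covariant, i.e. $\mu(\phi P) = |\det\phi|\,\phi\,\mu(P)\,\phi^t$ for all $P \in \mathcal{P}^2_o$ and all $\phi \in \mathrm{GL}(2)$. Then there exists $k \in \mathbb{R}$ such that $\mu(P) = k\, M_2(P)$ for all $P \in \mathcal{P}^2_o$.
   Context: $\mathcal{P}^2_o$ denotes the set of convex polygons in $\mathbb{R}^2$ containing the origin in their interiors, with the Hausdorff metric topology; "measurable" refers to Borel $\sigma$-algebras. A map $\mu$ on a family $\mathcal{S}$ of sets is a valuation if $\mu(K \cup L) + \mu(K \cap L) = \mu(K) + \mu(L)$ whenever $K, L, K\cup L, K \cap L \in \mathcal{S}$. The moment matrix is $M_2(P) = \int_P x\,x^t\,dx$. *)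

theory Defs
  imports "HOL-Analysis.Analysis"
begin

definition polygons_o :: "(real^2) set set" where
  "polygons_o = {P. polytope P \<and> (0::real^2) \<in> interior P}"

definition hausdist :: "(real^2) set \<Rightarrow> (real^2) set \<Rightarrow> real" where
  "hausdist K L = max (SUP x\<in>K. infdist x L) (SUP y\<in>L. infdist y K)"

definition hausdorff_open :: "(real^2) set set \<Rightarrow> bool" where
  "hausdorff_open U \<longleftrightarrow> U \<subseteq> polygons_o \<and>
     (\<forall>K\<in>U. \<exists>e>0. \<forall>L\<in>polygons_o. hausdist K L < e \<longrightarrow> L \<in> U)"

definition hausdorff_borel :: "(real^2) set set set" where
  "hausdorff_borel = sigma_sets polygons_o {U. hausdorff_open U}"

definition measurable_on_polygons :: "((real^2) set \<Rightarrow> real^2^2) \<Rightarrow> bool" where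
  "measurable_on_polygons \<mu> \<longleftrightarrow>
     (\<forall>B \<in> sets borel. {P \<in> polygons_o. \<mu> P \<in> B} \<in> hausdorff_borel)"

definition valuation_on :: "'a set set \<Rightarrow> ('a set \<Rightarrow> 'b::ab_group_add) \<Rightarrow> bool" where
  "valuation_on S \<mu> \<longleftrightarrow>
     (\<forall>K L. K \<in> S \<longrightarrow> L \<in> S \<longrightarrow> K \<union> L \<in> S \<longrightarrow> K \<inter> L \<in> S \<longrightarrow>
        \<mu> (K \<union> L) + \<mu> (K \<inter> L) = \<mu> K + \<mu> L)"

definition GL2_covariant :: "((real^2) set \<Rightarrow> real^2^2) \<Rightarrow> bool" where
  "GL2_covariant \<mu> \<longleftrightarrow>
     (\<forall>P \<in> polygons_o. \<forall>\<phi> :: real^2^2. invertible \<phi> \<longrightarrow>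
        \<mu> ((\<lambda>x. \<phi> *v x) ` P) = \<bar>det \<phi>\<bar> *\<^sub>R (\<phi> ** \<mu> P ** transpose \<phi>))"

definition moment_matrix :: "(real^2) set \<Rightarrow> real^2^2" where
  "moment_matrix P = (\<chi> i j. integral P (\<lambda>x. x $ i * x $ j))"

end

theory Submission
  imports Defs
begin

text \<open>
  Subtract from \<open>\<mu>\<close> the multiple of the moment matrix for which the \<open>(1,1)\<close>-entry of the
  difference \<open>\<nu>\<close> vanishes on the square with vertices \<open>\<plusminus>e\<^sub>1, \<plusminus>e\<^sub>2\<close>; then \<open>\<nu> = 0\<close> has to be shown.
  Cutting a polygon by a line through the origin and adding one small vertex to either half gives a
  valuation identity. On double pyramids (both diagonals pass through the origin) this makes \<open>\<nu>\<close>
  a sum over the four quadrants, and covariance under diagonal matrices leaves a single free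
  constant \<open>\<kappa>\<close> in the off-diagonal entries. On kites (one diagonal passes through the origin) the
  two halves contribute additively; equivariance under the triangular matrices fixing the diagonal
  determines these contributions, and the symmetry of the triangle \<open>e\<^sub>1, e\<^sub>2, -e\<^sub>1-e\<^sub>2\<close> gives \<open>\<kappa> = 0\<close>.
  Hence \<open>\<nu>\<close> vanishes on kites, in particular on triangles, and every polygon can be cut down to
  kites by lines through the origin and through pairs of vertices.
\<close>

section \<open>Convex hulls in the plane\<close>

text \<open>The valuation identity may only be used if the intersection of the two polygons still
  has the origin in its interior. The halves of a polygon on either side of a line through the
  origin do not qualify, as the origin lies on their boundary. So each half is closed off by a point
  from the other side, and the price is a fourth polygon, the intersection, which is a kite. This is
  why kites come first: once \<open>\<nu>\<close> vanishes on them, the fourth term drops out and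
  cutting becomes additive. The constant \<open>\<kappa>\<close> cannot be excluded on double
  pyramids. Integrating the product of the coordinates over a double pyramid gives (a*a - c*c) *
  (b*b - d*d) / 24, so the off-diagonal term has the same form as a true moment, and linear maps
  between double pyramids preserve the pair of axes. A triangle is a kite that also has symmetries
  moving the diagonal, and these see the difference.\<close>

lemma convex_hull_Int_halfspace_ge:
  fixes V :: "'a::real_inner set"
  shows "convex hull V \<inter> {x. s \<le> n \<bullet> x} =
    convex hull ((V \<inter> {x. s \<le> n \<bullet> x}) \<union> (convex hull V \<inter> {x. n \<bullet> x = s}))" (is "?L = convex hull ?R")
proof
  have cL: "convex ?L"
    by (intro convex_Int convex_convex_hull convex_halfspace_ge)
  show "convex hull ?R \<subseteq> ?L"
    by (rule hull_minimal[where S=convex, OF _ cL]) (auto intro: hull_inc)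
  \<comment> \<open>\<open>T\<close> collects the points of the hull that satisfy the claim; it
    suffices that \<open>T\<close> is convex and contains \<open>V\<close>. The only case with
    content is a segment that crosses the hyperplane.\<close>
  define T where "T = {x \<in> convex hull V. s \<le> n \<bullet> x \<longrightarrow> x \<in> convex hull ?R}"
  have cross: "z \<in> convex hull ?R"
    if x: "x \<in> T" "s \<le> n \<bullet> x" and y: "y \<in> T" "n \<bullet> y < s" and z: "z \<in> closed_segment x y" "s \<le> n \<bullet> z" for x y z
  proof -
    obtain u where u: "0 \<le> u" "u \<le> 1" "z = (1 - u) *\<^sub>R x + u *\<^sub>R y"
      using z by (auto simp: in_segment)
    \<comment> \<open>The weight for which \<open>c\<close> below is the crossing point of the
      segment with the hyperplane; \<open>z\<close> then lies between \<open>x\<close> and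
      \<open>c\<close>.\<close>
    define w where "w = (n \<bullet> x - s) / (n \<bullet> x - n \<bullet> y)"
    have w: "0 \<le> w" "w \<le> 1"
      using x y by (auto simp: w_def divide_simps)
    define c where "c = (1 - w) *\<^sub>R x + w *\<^sub>R y"
    have nc: "n \<bullet> c = s"
    proof -
      have "n \<bullet> c = n \<bullet> x - w * (n \<bullet> x - n \<bullet> y)"
        by (simp add: c_def inner_simps algebra_simps)
      then show ?thesis using x y by (simp add: w_def)
    qed
    have cV: "c \<in> convex hull V"
      unfolding c_def using x y w by (intro convexD_alt) (auto simp: T_def)
    have "c \<in> convex hull ?R"
      using cV nc by (intro hull_inc) auto
    moreover have "x \<in> convex hull ?R"
      using x by (auto simp: T_def)
    moreover have "z \<in> closed_segment x c"
    proof (cases "w = 0")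
      case True
      then have "n \<bullet> x = s" using x y by (auto simp: w_def)
      then have "u = 0"
        using z y u by (auto simp: inner_simps algebra_simps) (smt (verit) mult_pos_pos right_diff_distrib)
      then show ?thesis using u by simp
    next
      case False
      have "n \<bullet> z = n \<bullet> x - u * (n \<bullet> x - n \<bullet> y)"
        unfolding u by (simp add: inner_simps algebra_simps)
      then have "u \<le> w"
        using z x y unfolding w_def by (simp add: field_simps)
      then have "0 \<le> u / w" "u / w \<le> 1" using u w False by auto
      moreover have "z = (1 - u / w) *\<^sub>R x + (u / w) *\<^sub>R c"
        unfolding u c_def using False by (simp add: algebra_simps)
      ultimately show ?thesis by (auto simp: in_segment)
    qed
    ultimately show ?thesis
      using convex_contains_segment convex_convex_hull by (metis subsetD)
  qed
  have "convex T"
    unfolding convex_contains_segment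
  proof (intro ballI subsetI)
    fix x y z assume xyz: "x \<in> T" "y \<in> T" "z \<in> closed_segment x y"
    have zV: "z \<in> convex hull V"
      using xyz convex_contains_segment[of "convex hull V"] by (auto simp: T_def)
    have "z \<in> convex hull ?R" if sz: "s \<le> n \<bullet> z"
    proof -
      consider "s \<le> n \<bullet> x" "s \<le> n \<bullet> y" | "s \<le> n \<bullet> x" "n \<bullet> y < s" | "n \<bullet> x < s" "s \<le> n \<bullet> y" | "n \<bullet> x < s" "n \<bullet> y < s"
        by linarith
      then show ?thesis
      proof cases
        case 1
        then show ?thesis
          using xyz convex_contains_segment[of "convex hull ?R"] by (auto simp: T_def)
      next
        case 2 then show ?thesis using cross xyz sz by blast
      next
        case 3 then show ?thesis using cross[of y x z] xyz sz by (simp add: closed_segment_commute)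
      next
        case 4
        then have "z \<in> {x. n \<bullet> x < s}"
          using xyz convex_halfspace_lt[of n s] unfolding convex_contains_segment by blast
        then show ?thesis using sz by simp
      qed
    qed
    then show "z \<in> T" using zV by (simp add: T_def)
  qed
  moreover have "V \<subseteq> T"
    by (auto simp: T_def intro!: hull_inc)
  ultimately have "convex hull V \<subseteq> T"
    by (intro hull_minimal)
  then show "?L \<subseteq> convex hull ?R"
    by (auto simp: T_def)
qed

lemma convex_hull_Int_halfspace_le:
  fixes V :: "'a::real_inner set"
  shows "convex hull V \<inter> {x. n \<bullet> x \<le> s} =
    convex hull ((V \<inter> {x. n \<bullet> x \<le> s}) \<union> (convex hull V \<inter> {x. n \<bullet> x = s}))"
  using convex_hull_Int_halfspace_ge[of V "-s" "-n"] by simp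

lemma convex_hull_convex_hull_Un:
  "convex hull (convex hull A \<union> B) = convex hull (A \<union> B)"
  by (metis hull_Un_left)

lemma interior_convex_hull_imp_ex_pos:
  fixes S :: "'a::euclidean_space set"
  assumes "0 \<in> interior (convex hull S)" "n \<noteq> 0"
  shows "\<exists>x\<in>S. 0 < n \<bullet> x"
proof (rule ccontr)
  assume "\<not> ?thesis"
  then have "S \<subseteq> {x. n \<bullet> x \<le> 0}" by force
  then have sub: "convex hull S \<subseteq> {x. n \<bullet> x \<le> 0}"
    by (intro hull_minimal convex_halfspace_le)
  obtain e where e: "e > 0" "cball 0 e \<subseteq> convex hull S"
    using assms by (auto simp: mem_interior_cball)
  have "(e / norm n) *\<^sub>R n \<in> cball 0 e" using e assms by simp
  then have "n \<bullet> ((e / norm n) *\<^sub>R n) \<le> 0" using e sub by blast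
  moreover have "n \<bullet> ((e / norm n) *\<^sub>R n) > 0" using e assms by simp
  ultimately show False by simp
qed

lemma zero_in_interior_convex_hull:
  fixes S :: "'a::euclidean_space set"
  assumes pos: "\<And>n. n \<noteq> 0 \<Longrightarrow> \<exists>x\<in>S. 0 < n \<bullet> x"
  shows "0 \<in> interior (convex hull S)"
proof (rule ccontr)
  let ?C = "convex hull S"
  assume nin: "0 \<notin> interior ?C"
  \<comment> \<open>A hull without interior lies in a hyperplane, whose normal is oriented by the
    sign of \<open>b\<close>; otherwise the origin is separated from the interior.\<close>
  have "\<exists>a. a \<noteq> 0 \<and> (\<forall>x\<in>S. a \<bullet> x \<ge> 0)"
  proof (cases "interior ?C = {}")
    case True
    then obtain a b where ab: "a \<noteq> 0" "?C \<subseteq> {x. a \<bullet> x = b}"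
      using empty_interior_subset_hyperplane[of ?C] by auto
    then have *: "\<forall>x\<in>S. a \<bullet> x = b" using hull_subset[of S convex] by blast
    show ?thesis
    proof (cases "b \<ge> 0")
      case True then show ?thesis using ab * by auto
    next
      case False then show ?thesis using ab * by (intro exI[of _ "-a"]) auto
    qed
  next
    case False
    obtain a b where ab: "a \<noteq> 0" "\<forall>x\<in>{0}. a \<bullet> x \<le> b" "\<forall>x\<in>interior ?C. b \<le> a \<bullet> x"
      using separating_hyperplane_sets[of "{0}" "interior ?C"] nin False
      by (auto simp: convex_interior)
    then have "interior ?C \<subseteq> {x. 0 \<le> a \<bullet> x}" by force
    then have "closure (interior ?C) \<subseteq> {x. 0 \<le> a \<bullet> x}"
      by (intro closure_minimal closed_halfspace_ge)
    then have "?C \<subseteq> {x. 0 \<le> a \<bullet> x}"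
      using convex_closure_interior[of ?C] False closure_subset by auto
    then show ?thesis using ab hull_subset[of S convex] by blast
  qed
  then obtain a where a: "a \<noteq> 0" "\<forall>x\<in>S. a \<bullet> x \<ge> 0" by blast
  then show False using pos[of "-a"] by force
qed

lemma polygons_o_convex_hull_iff:
  assumes "finite S"
  shows "convex hull S \<in> polygons_o \<longleftrightarrow> (\<forall>n. n \<noteq> 0 \<longrightarrow> (\<exists>x\<in>S. 0 < n \<bullet> x))"
  using assms interior_convex_hull_imp_ex_pos zero_in_interior_convex_hull
  unfolding polygons_o_def polytope_def by blast

lemma polygons_oE:
  assumes "P \<in> polygons_o"
  obtains V where "finite V" "P = convex hull V"
  using assms by (auto simp: polygons_o_def polytope_def)

lemma polygons_o_superset:
  assumes "finite S" "M \<in> polygons_o" "M \<subseteq> convex hull S"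
  shows "convex hull S \<in> polygons_o"
  using assms interior_mono unfolding polygons_o_def polytope_def by blast

text \<open>A quarter turn. The product \<open>perp d \<bullet> x\<close> is the determinant with
  columns \<open>d\<close> and \<open>x\<close>, so its sign tells on which side of the line through
  \<open>d\<close> the point \<open>x\<close> lies.\<close>

definition perp :: "real^2 \<Rightarrow> real^2" where
  "perp d = vector [- d $ 2, d $ 1]"

lemma inner_real2: "x \<bullet> y = x $ 1 * y $ 1 + x $ 2 * y $ 2" for x y :: "real^2"
  by (simp add: inner_vec_def sum_2)

lemma perp_inner: "perp d \<bullet> x = d $ 1 * x $ 2 - d $ 2 * x $ 1"
  by (simp add: perp_def inner_real2)

lemma vec2_eq_iff: "x = y \<longleftrightarrow> x $ 1 = y $ 1 \<and> x $ 2 = y $ 2" for x y :: "'a^2"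
  by (simp add: vec_eq_iff forall_2)

lemma perp_inner_eq_0_iff:
  assumes "d \<noteq> 0"
  shows "perp d \<bullet> x = 0 \<longleftrightarrow> (\<exists>t. x = t *\<^sub>R d)"
proof
  assume *: "perp d \<bullet> x = 0"
  have d: "d \<bullet> d \<noteq> 0" using assms by simp
  have "(d \<bullet> d) *\<^sub>R x = (d \<bullet> x) *\<^sub>R d"
    using * unfolding perp_inner vec2_eq_iff by (simp add: inner_real2) algebra
  then have "x = ((d \<bullet> x) / (d \<bullet> d)) *\<^sub>R d"
    using d by (metis (no_types, lifting) divideR_right divide_inverse_commute scaleR_scaleR)
  then show "\<exists>t. x = t *\<^sub>R d" by blast
qed (auto simp: perp_inner algebra_simps)

lemma perp_eq_0_iff [simp]: "perp d = 0 \<longleftrightarrow> d = 0"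
  by (auto simp: perp_def vec2_eq_iff)

lemma polygons_o_small_multiple:
  assumes "P \<in> polygons_o"
  shows "\<exists>e>0. e *\<^sub>R x \<in> P"
proof -
  obtain r where r: "r > 0" "cball 0 r \<subseteq> P"
    using assms by (auto simp: polygons_o_def mem_interior_cball)
  have "(r / (norm x + 1)) *\<^sub>R x \<in> cball 0 r"
    using r by (auto simp: divide_simps) (smt (verit) norm_ge_zero mult_left_mono mult_nonneg_nonneg distrib_left)
  then show ?thesis using r by (intro exI[of _ "r / (norm x + 1)"]) (auto simp: divide_pos_pos add_nonneg_pos)
qed

text \<open>A compact convex collinear set is a segment. Small positive multiples of
  \<open>d\<close> and of \<open>- d\<close> lie in \<open>P\<close>, so the ends fall strictly on
  opposite sides of the origin.\<close>

lemma polygons_o_Int_line: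
  assumes P: "P \<in> polygons_o" and d: "d \<noteq> 0"
  obtains a b where "a > 0" "b > 0" "P \<inter> {x. perp d \<bullet> x = 0} = convex hull {a *\<^sub>R d, - (b *\<^sub>R d)}"
proof -
  let ?S = "P \<inter> {x. perp d \<bullet> x = 0}"
  obtain e where e: "e > 0" "e *\<^sub>R d \<in> P" using polygons_o_small_multiple[OF P] by blast
  obtain f where f: "f > 0" "f *\<^sub>R (-d) \<in> P" using polygons_o_small_multiple[OF P] by blast
  have P': "compact P" "convex P"
    using P by (auto simp: polygons_o_def polytope_imp_compact polytope_imp_convex)
  have eS: "e *\<^sub>R d \<in> ?S" and fS: "f *\<^sub>R (-d) \<in> ?S"
    using e f by (auto simp: perp_inner)
  have "compact ?S"
    using P' closed_hyperplane by (intro compact_Int_closed) auto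
  moreover have "convex ?S" using P' convex_hyperplane by (intro convex_Int) auto
  moreover have "collinear ?S"
    unfolding collinear_def
  proof (intro exI[of _ d] ballI)
    fix x y assume "x \<in> ?S" "y \<in> ?S"
    then obtain s t where "x = s *\<^sub>R d" "y = t *\<^sub>R d" using perp_inner_eq_0_iff[OF d] by auto
    then show "\<exists>c. x - y = c *\<^sub>R d" by (metis scaleR_left_diff_distrib)
  qed
  ultimately obtain p q where pq: "?S = closed_segment p q"
    using compact_convex_collinear_segment eS by (metis empty_iff)
  have "p \<in> ?S" "q \<in> ?S" using pq by auto
  then obtain s t where st: "p = s *\<^sub>R d" "q = t *\<^sub>R d"
    using perp_inner_eq_0_iff[OF d] by auto
  have seg: "\<exists>u. 0 \<le> u \<and> u \<le> 1 \<and> c = (1 - u) * s + u * t" if cd: "c *\<^sub>R d \<in> ?S" for c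
  proof -
    obtain u where "0 \<le> u" "u \<le> 1" "c *\<^sub>R d = (1 - u) *\<^sub>R p + u *\<^sub>R q"
      using cd unfolding pq by (auto simp: in_segment)
    then show ?thesis
      using d unfolding st by (intro exI[of _ u]) (metis scaleR_left.add scaleR_cancel_right scaleR_scaleR)
  qed
  obtain u1 where u1: "0 \<le> u1" "u1 \<le> 1" "e = (1 - u1) * s + u1 * t" using seg eS by blast
  obtain u2 where u2: "0 \<le> u2" "u2 \<le> 1" "- f = (1 - u2) * s + u2 * t"
    using seg[of "-f"] fS by auto
  have "s > 0 \<or> t > 0"
  proof (rule ccontr)
    assume "\<not> ?thesis"
    then have "(1 - u1) * s \<le> 0" "u1 * t \<le> 0" using u1 by (auto simp: mult_le_0_iff)
    then show False using u1 e by linarith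
  qed
  moreover have "s < 0 \<or> t < 0"
  proof (rule ccontr)
    assume "\<not> ?thesis"
    then have "(1 - u2) * s \<ge> 0" "u2 * t \<ge> 0" using u2 by auto
    then show False using u2 f by linarith
  qed
  ultimately consider "s > 0" "t < 0" | "s < 0" "t > 0" by linarith
  then show ?thesis
  proof cases
    case 1
    then show ?thesis using that[of s "-t"] pq st by (simp add: segment_convex_hull)
  next
    case 2
    then show ?thesis using that[of t "-s"] pq st by (simp add: segment_convex_hull insert_commute)
  qed
qed

section \<open>Cutting polygons\<close>

text \<open>The weighted point in the last assumption is where the segment from \<open>u\<close> to
  \<open>v\<close> meets the hyperplane. In any convex combination on the hyperplane the weights of
  \<open>u\<close> and \<open>v\<close> balance, hence are proportional to those of this point, and
  their joint contribution is a multiple of it.\<close>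

lemma convex_hull_Int_hyperplane_eq_segment:
  fixes n :: "'a::real_inner"
  assumes pq: "n \<bullet> p = 0" "n \<bullet> q = 0" and uv: "n \<bullet> u > 0" "n \<bullet> v < 0"
    and c: "(1 / (n \<bullet> u - n \<bullet> v)) *\<^sub>R ((- (n \<bullet> v)) *\<^sub>R u + (n \<bullet> u) *\<^sub>R v) \<in> convex hull {p, q}" (is "?c \<in> _")
  shows "convex hull {p, q, u, v} \<inter> {x. n \<bullet> x = 0} = convex hull {p, q}"
proof
  have "convex hull {p, q} \<subseteq> {x. n \<bullet> x = 0}"
    using pq by (intro hull_minimal convex_hyperplane) auto
  moreover have "convex hull {p, q} \<subseteq> convex hull {p, q, u, v}"
    by (intro hull_mono) auto
  ultimately show "convex hull {p, q} \<subseteq> convex hull {p, q, u, v} \<inter> {x. n \<bullet> x = 0}" by blast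
  show "convex hull {p, q, u, v} \<inter> {x. n \<bullet> x = 0} \<subseteq> convex hull {p, q}"
  proof
    fix x assume x: "x \<in> convex hull {p, q, u, v} \<inter> {x. n \<bullet> x = 0}"
    have "{p, q, u, v} = insert u (insert v {p, q})" by auto
    then have "x \<in> convex hull (insert u (insert v {p, q}))" using x by simp
    then obtain \<alpha> y where a: "0 \<le> \<alpha>" "\<alpha> \<le> 1" "x = (1 - \<alpha>) *\<^sub>R u + \<alpha> *\<^sub>R y" "y \<in> convex hull (insert v {p, q})"
      by (subst (asm) convex_hull_insert_alt) auto
    then obtain \<beta> z where b: "0 \<le> \<beta>" "\<beta> \<le> 1" "y = (1 - \<beta>) *\<^sub>R v + \<beta> *\<^sub>R z" "z \<in> convex hull {p, q}"
      by (subst (asm) convex_hull_insert_alt) auto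
    have nz: "n \<bullet> z = 0"
      using b \<open>convex hull {p, q} \<subseteq> {x. n \<bullet> x = 0}\<close> by blast
    define \<gamma> where "\<gamma> = \<alpha> * (1 - \<beta>)"
    have bal: "(1 - \<alpha>) * (n \<bullet> u) = - \<gamma> * (n \<bullet> v)"
      using x a(3) b(3) nz by (simp add: inner_simps \<gamma>_def)
    define \<rho> where "\<rho> = (1 - \<alpha>) + \<gamma>"
    let ?D = "n \<bullet> u - n \<bullet> v"
    have D: "?D > 0" using uv by simp
    have "\<rho> * (- (n \<bullet> v)) = (1 - \<alpha>) * ?D" "\<rho> * (n \<bullet> u) = \<gamma> * ?D"
      using bal by (simp_all add: \<rho>_def algebra_simps)
    then have coef: "\<rho> * (1 / ?D) * (- (n \<bullet> v)) = 1 - \<alpha>" "\<rho> * (1 / ?D) * (n \<bullet> u) = \<gamma>"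
      using D by (simp_all add: field_simps)
    have "\<rho> *\<^sub>R ?c = (\<rho> * (1 / ?D) * (- (n \<bullet> v))) *\<^sub>R u + (\<rho> * (1 / ?D) * (n \<bullet> u)) *\<^sub>R v"
      by (simp add: scaleR_right_diff_distrib)
    then have rc: "\<rho> *\<^sub>R ?c = (1 - \<alpha>) *\<^sub>R u + \<gamma> *\<^sub>R v" unfolding coef .
    have "x = \<rho> *\<^sub>R ?c + (\<alpha> * \<beta>) *\<^sub>R z"
      unfolding rc a(3) b(3) \<gamma>_def by (simp add: algebra_simps)
    moreover have "\<rho> \<ge> 0" "\<alpha> * \<beta> \<ge> 0" "\<rho> + \<alpha> * \<beta> = 1"
      using a(1,2) b(1,2) by (simp_all add: \<rho>_def \<gamma>_def) (simp add: algebra_simps)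
    ultimately show "x \<in> convex hull {p, q}"
      using convexD[OF convex_convex_hull c b(4)] by simp
  qed
qed

lemma scaleR_in_convex_hull:
  assumes "0 \<in> convex hull S" "0 \<le> t" "t \<le> 1"
  shows "t *\<^sub>R u \<in> convex hull (insert u S)"
proof -
  have "0 \<in> convex hull (insert u S)"
    using assms hull_mono[of S "insert u S" convex] by blast
  then show ?thesis
    using convexD_alt[OF convex_convex_hull, of 0 "insert u S" u t] assms by (simp add: hull_inc)
qed

section \<open>Coordinates and two-by-two matrices\<close>

definition vc :: "real \<Rightarrow> real \<Rightarrow> real^2" where
  "vc x y = vector [x, y]"

lemma vc_nth [simp]: "vc x y $ 1 = x" "vc x y $ 2 = y"
  by (simp_all add: vc_def)

lemma scaleR_vc [simp]: "t *\<^sub>R vc x y = vc (t * x) (t * y)"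
  and uminus_vc [simp]: "- vc x y = vc (- x) (- y)"
  and add_vc [simp]: "vc x y + vc x' y' = vc (x + x') (y + y')"
  and vc_eta: "v = vc (v $ 1) (v $ 2)"
  and zero_vc: "0 = vc 0 0"
  and vc_eq_iff [simp]: "vc x y = vc x' y' \<longleftrightarrow> x = x' \<and> y = y'"
  and inner_vc [simp]: "vc x y \<bullet> w = x * w $ 1 + y * w $ 2"
  by (simp_all add: vec2_eq_iff inner_real2)

definition mat2 :: "real \<Rightarrow> real \<Rightarrow> real \<Rightarrow> real \<Rightarrow> real^2^2" where
  "mat2 p q r s = vector [vector [p, q], vector [r, s]]"

lemma mat2_nth [simp]:
  "mat2 p q r s $ 1 $ 1 = p" "mat2 p q r s $ 1 $ 2 = q"
  "mat2 p q r s $ 2 $ 1 = r" "mat2 p q r s $ 2 $ 2 = s"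
  by (simp_all add: mat2_def)

lemma det_mat2 [simp]: "det (mat2 p q r s) = p * s - q * r"
  by (simp add: det_2)

lemma mat2_mult_vc [simp]: "mat2 p q r s *v vc x y = vc (p * x + q * y) (r * x + s * y)"
  by (simp add: vec2_eq_iff matrix_vector_mult_def sum_2)

lemma congruence_mat2_nth:
  fixes M :: "real^2^2"
  shows "(mat2 p q r s ** M ** transpose (mat2 p q r s)) $ 1 $ 1 = p * p * M$1$1 + p * q * M$1$2 + p * q * M$2$1 + q * q * M$2$2"
    and "(mat2 p q r s ** M ** transpose (mat2 p q r s)) $ 1 $ 2 = p * r * M$1$1 + p * s * M$1$2 + q * r * M$2$1 + q * s * M$2$2"
    and "(mat2 p q r s ** M ** transpose (mat2 p q r s)) $ 2 $ 1 = p * r * M$1$1 + q * r * M$1$2 + p * s * M$2$1 + q * s * M$2$2"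
    and "(mat2 p q r s ** M ** transpose (mat2 p q r s)) $ 2 $ 2 = r * r * M$1$1 + r * s * M$1$2 + r * s * M$2$1 + s * s * M$2$2"
  by (simp_all add: matrix_matrix_mult_def sum_2 transpose_def algebra_simps)

lemma mat22_eq_iff: "M = N \<longleftrightarrow> M$1$1 = N$1$1 \<and> M$1$2 = N$1$2 \<and> M$2$1 = N$2$1 \<and> M$2$2 = N$2$2"
  for M N :: "'a^2^2"
  by (auto simp: vec_eq_iff forall_2)

section \<open>Valuation identities obtained by cutting\<close>

locale covariant_valuation =
  fixes \<nu> :: "(real^2) set \<Rightarrow> real^2^2"
  assumes valuation: "valuation_on polygons_o \<nu>"
    and covariant: "GL2_covariant \<nu>"
begin

text \<open>The two pieces, each closed off by points from beyond the line, have union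
  \<open>P\<close> and intersection \<open>?M\<close>. Both contain \<open>?M\<close>, so only
  \<open>?M\<close> has to be known to have the origin in its interior. The level \<open>s\<close>
  is arbitrary because a pentagon is later cut along a line that misses the origin.\<close>

lemma cut:
  fixes n :: "real^2"
  assumes P: "P \<in> polygons_o"
    and U: "finite U" "U \<subseteq> P" "\<And>x. x \<in> U \<Longrightarrow> s \<le> n \<bullet> x"
    and W: "finite W" "W \<subseteq> P" "\<And>x. x \<in> W \<Longrightarrow> n \<bullet> x \<le> s"
    and M: "convex hull (P \<inter> {x. n \<bullet> x = s} \<union> U \<union> W) \<in> polygons_o" (is "?M \<in> _")
  shows "\<nu> P + \<nu> (convex hull (P \<inter> {x. n \<bullet> x = s} \<union> U \<union> W)) =
    \<nu> (convex hull (P \<inter> {x. s \<le> n \<bullet> x} \<union> W)) + \<nu> (convex hull (P \<inter> {x. n \<bullet> x \<le> s} \<union> U))"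
proof -
  let ?ge = "{x. s \<le> n \<bullet> x}" and ?le = "{x. n \<bullet> x \<le> s}" and ?h = "{x. n \<bullet> x = s}"
  let ?K = "convex hull (P \<inter> ?ge \<union> W)" and ?L = "convex hull (P \<inter> ?le \<union> U)"
  have pP: "polytope P" and cP: "convex P"
    using P by (auto simp: polygons_o_def polytope_imp_convex)
  have KP: "?K \<subseteq> P" and LP: "?L \<subseteq> P" and MP: "?M \<subseteq> P"
    by (rule hull_minimal; use cP U W in auto)+
  have geK: "P \<inter> ?ge \<subseteq> ?K" and leL: "P \<inter> ?le \<subseteq> ?L" and hM: "P \<inter> ?h \<subseteq> ?M"
    by (auto intro: hull_inc)
  have Kh: "?K \<inter> ?h = P \<inter> ?h" and Lh: "?L \<inter> ?h = P \<inter> ?h" and Mh: "?M \<inter> ?h = P \<inter> ?h"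
    using KP LP MP geK leL hM by auto
  have "(P \<inter> ?ge \<union> W) \<inter> ?le \<union> P \<inter> ?h = P \<inter> ?h \<union> W"
    using W by auto
  then have Kle: "?K \<inter> ?le = convex hull (P \<inter> ?h \<union> W)"
    using convex_hull_Int_halfspace_le[of "P \<inter> ?ge \<union> W" n s] Kh by simp
  have "(P \<inter> ?le \<union> U) \<inter> ?ge \<union> P \<inter> ?h = P \<inter> ?h \<union> U"
    using U by auto
  then have Lge: "?L \<inter> ?ge = convex hull (P \<inter> ?h \<union> U)"
    using convex_hull_Int_halfspace_ge[of "P \<inter> ?le \<union> U" s n] Lh by simp
  have "(P \<inter> ?h \<union> U \<union> W) \<inter> ?ge \<union> P \<inter> ?h = P \<inter> ?h \<union> U"
    using U W by force
  then have Mge: "?M \<inter> ?ge = convex hull (P \<inter> ?h \<union> U)"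
    using convex_hull_Int_halfspace_ge[of "P \<inter> ?h \<union> U \<union> W" s n] Mh by simp
  have "(P \<inter> ?h \<union> U \<union> W) \<inter> ?le \<union> P \<inter> ?h = P \<inter> ?h \<union> W"
    using U W by force
  then have Mle: "?M \<inter> ?le = convex hull (P \<inter> ?h \<union> W)"
    using convex_hull_Int_halfspace_le[of "P \<inter> ?h \<union> U \<union> W" n s] Mh by simp
  have all: "A = A \<inter> ?ge \<union> A \<inter> ?le" for A by auto
  \<comment> \<open>On this side \<open>?K\<close> is all of \<open>P\<close>, so the intersection
    is what \<open>?L\<close> has there; on the other side the roles are exchanged.\<close>
  have KLge: "?K \<inter> ?L \<inter> ?ge = ?M \<inter> ?ge"
    using Lge Mge LP geK by blast
  have KLle: "?K \<inter> ?L \<inter> ?le = ?M \<inter> ?le"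
    using Kle Mle KP leL by blast
  have KL: "?K \<inter> ?L = ?M"
    using all[of "?K \<inter> ?L"] all[of ?M] KLge KLle by simp
  have KuL: "?K \<union> ?L = P"
    using all[of P] KP LP geK leL by blast
  have poly: "polytope (convex hull (A \<union> B))" if A: "polytope A" and B: "finite B" for A B :: "(real^2) set"
  proof -
    obtain S where "finite S" "A = convex hull S" using A by (auto simp: polytope_def)
    then show ?thesis using B convex_hull_convex_hull_Un[of S B] unfolding polytope_def
      by (metis finite_UnI)
  qed
  have "polytope (P \<inter> ?ge)" "polytope (P \<inter> ?le)"
    by (intro polytope_Int_polyhedron pP polyhedron_halfspace_ge polyhedron_halfspace_le)+
  then have "polytope ?K" "polytope ?L"
    using poly U W by blast+
  moreover have "?M \<subseteq> ?K" "?M \<subseteq> ?L" using KL by blast+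
  ultimately have "?K \<in> polygons_o" "?L \<in> polygons_o"
    using M interior_mono unfolding polygons_o_def by blast+
  then show ?thesis
    using valuation KL KuL P M unfolding valuation_on_def by metis
qed

text \<open>By \<open>h\<close> the line meets the kite exactly in the diagonal from
  \<open>p\<close> to \<open>q\<close>, so cutting there and adding one point to each half again
  gives hulls of this diagonal and two points. With the diagonal fixed, the value thus separates
  into a part depending on \<open>u\<close> and a part depending on \<open>v\<close>.\<close>

lemma kite_exchange:
  fixes n :: "real^2"
  assumes P: "convex hull {p, q, u, v} \<in> polygons_o"
    and pq: "n \<bullet> p = 0" "n \<bullet> q = 0" and uv: "n \<bullet> u > 0" "n \<bullet> v < 0"
    and h: "convex hull {p, q, u, v} \<inter> {x. n \<bullet> x = 0} = convex hull {p, q}"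
    and u1: "u1 \<in> convex hull {p, q, u}" "n \<bullet> u1 > 0"
    and v1: "v1 \<in> convex hull {p, q, v}" "n \<bullet> v1 < 0"
    and M: "convex hull {p, q, u1, v1} \<in> polygons_o"
  shows "\<nu> (convex hull {p, q, u, v}) + \<nu> (convex hull {p, q, u1, v1}) =
    \<nu> (convex hull {p, q, u, v1}) + \<nu> (convex hull {p, q, u1, v})"
proof -
  let ?P = "convex hull {p, q, u, v}"
  have sub: "convex hull {p, q, u} \<subseteq> ?P" "convex hull {p, q, v} \<subseteq> ?P"
    by (intro hull_mono; auto)+
  have V1: "{p, q, u, v} \<inter> {x. 0 \<le> n \<bullet> x} = {p, q, u}"
    and V2: "{p, q, u, v} \<inter> {x. n \<bullet> x \<le> 0} = {p, q, v}"
    using pq uv by auto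
  have absorb: "convex hull (A \<union> convex hull {p, q} \<union> B) = convex hull (A \<union> B)" if "{p, q} \<subseteq> A" for A B
  proof -
    have "A \<union> convex hull {p, q} \<union> B = convex hull {p, q} \<union> (A \<union> B)" by blast
    then have "convex hull (A \<union> convex hull {p, q} \<union> B) = convex hull ({p, q} \<union> (A \<union> B))"
      using convex_hull_convex_hull_Un by metis
    also have "{p, q} \<union> (A \<union> B) = A \<union> B" using that by blast
    finally show ?thesis .
  qed
  have ge: "?P \<inter> {x. 0 \<le> n \<bullet> x} = convex hull {p, q, u}"
    using convex_hull_Int_halfspace_ge[of "{p, q, u, v}" 0 n] absorb[of "{p,q,u}" "{}"] unfolding h V1 by simp
  have le: "?P \<inter> {x. n \<bullet> x \<le> 0} = convex hull {p, q, v}"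
    using convex_hull_Int_halfspace_le[of "{p, q, u, v}" n 0] absorb[of "{p,q,v}" "{}"] unfolding h V2 by simp
  have Me: "convex hull (?P \<inter> {x. n \<bullet> x = 0} \<union> {u1} \<union> {v1}) = convex hull {p, q, u1, v1}"
    unfolding h Un_assoc convex_hull_convex_hull_Un by (simp add: insert_commute)
  have Ke: "convex hull (?P \<inter> {x. 0 \<le> n \<bullet> x} \<union> {v1}) = convex hull {p, q, u, v1}"
    unfolding ge convex_hull_convex_hull_Un by (simp add: insert_commute)
  have Le: "convex hull (?P \<inter> {x. n \<bullet> x \<le> 0} \<union> {u1}) = convex hull {p, q, u1, v}"
    unfolding le convex_hull_convex_hull_Un by (simp add: insert_commute)
  show ?thesis
    using cut[OF P, of "{u1}" 0 n "{v1}"] u1 v1 sub M unfolding Me Ke Le by auto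
qed

lemma transform:
  assumes "finite S" "convex hull S \<in> polygons_o" "p * s - q * r \<noteq> 0"
  shows "\<nu> (convex hull ((*v) (mat2 p q r s) ` S)) =
    \<bar>p * s - q * r\<bar> *\<^sub>R (mat2 p q r s ** \<nu> (convex hull S) ** transpose (mat2 p q r s))"
proof -
  have "invertible (mat2 p q r s)" using assms by (simp add: invertible_det_nz)
  then show ?thesis
    using covariant assms convex_hull_linear_image[OF matrix_vector_mul_linear[of "mat2 p q r s"], of S]
    unfolding GL2_covariant_def by (metis det_mat2)
qed

end

section \<open>Double pyramids\<close>

definition double_pyramid :: "real \<Rightarrow> real \<Rightarrow> real \<Rightarrow> real \<Rightarrow> (real^2) set" where
  "double_pyramid a b c d = convex hull {vc a 0, vc (- c) 0, vc 0 b, vc 0 (- d)}"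

lemma kite_in_polygons_o:
  assumes "a > 0" "c > 0" "u $ 2 > 0" "v $ 2 < 0"
  shows "convex hull {vc a 0, vc (- c) 0, u, v} \<in> polygons_o"
proof -
  have "\<exists>x\<in>{vc a 0, vc (- c) 0, u, v}. 0 < n \<bullet> x" if n: "n \<noteq> 0" for n :: "real^2"
  proof -
    consider "n $ 1 > 0" | "n $ 1 < 0" | "n $ 1 = 0" "n $ 2 > 0" | "n $ 1 = 0" "n $ 2 < 0"
      using n by (metis linorder_less_linear vec2_eq_iff zero_index)
    then show ?thesis
      using assms by cases (auto simp: inner_real2 mult_neg_neg mult_neg_pos)
  qed
  then show ?thesis by (simp add: polygons_o_convex_hull_iff)
qed

lemma double_pyramid_in_polygons_o:
  assumes "a > 0" "b > 0" "c > 0" "d > 0"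
  shows "double_pyramid a b c d \<in> polygons_o"
  unfolding double_pyramid_def using assms by (intro kite_in_polygons_o) auto

lemma vc_0_in_segment:
  assumes "- c \<le> x" "x \<le> a" "a > 0" "c > 0"
  shows "vc x 0 \<in> convex hull {vc a 0, vc (- c) 0}"
proof -
  define r where "r = (a - x) / (a + c)"
  have "r * (a + c) = a - x"
    using assms by (simp add: r_def)
  then have "vc x 0 = (1 - r) *\<^sub>R vc a 0 + r *\<^sub>R vc (- c) 0"
    by (simp add: algebra_simps)
  moreover have "0 \<le> r" "r \<le> 1"
    using assms by (auto simp: r_def field_simps)
  ultimately show ?thesis
    unfolding segment_convex_hull[symmetric] in_segment by blast
qed

text \<open>Compatibility says that \<open>vc a 0\<close> and \<open>vc (- c) 0\<close> are the points where the horizontal axis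
  leaves the kite.\<close>

definition compatible :: "real \<Rightarrow> real \<Rightarrow> real^2 \<Rightarrow> real^2 \<Rightarrow> bool" where
  "compatible a c u v \<longleftrightarrow> u $ 2 > 0 \<and> v $ 2 < 0 \<and>
    convex hull {vc a 0, vc (- c) 0, u, v} \<inter> {x. x $ 2 = 0} = convex hull {vc a 0, vc (- c) 0}"

text \<open>The last two conditions, divided by \<open>u $ 2 - v $ 2\<close>, place the point where
  the segment from \<open>u\<close> to \<open>v\<close> crosses the horizontal axis between
  \<open>- c\<close> and \<open>a\<close>.\<close>

lemma compatibleI:
  assumes "a > 0" "c > 0" "u $ 2 > 0" "v $ 2 < 0"
    and "- c * (u $ 2 - v $ 2) \<le> v $ 1 * u $ 2 - u $ 1 * v $ 2"
    and "v $ 1 * u $ 2 - u $ 1 * v $ 2 \<le> a * (u $ 2 - v $ 2)"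
  shows "compatible a c u v"
proof -
  let ?x = "(v $ 1 * u $ 2 - u $ 1 * v $ 2) / (u $ 2 - v $ 2)"
  have "vc ?x 0 \<in> convex hull {vc a 0, vc (- c) 0}"
    using assms by (intro vc_0_in_segment) (auto simp: field_simps)
  moreover have "vc ?x 0 = (1 / (vc 0 1 \<bullet> u - vc 0 1 \<bullet> v)) *\<^sub>R ((- (vc 0 1 \<bullet> v)) *\<^sub>R u + (vc 0 1 \<bullet> u) *\<^sub>R v)"
    using assms by (simp add: vec2_eq_iff diff_divide_distrib mult.commute)
  ultimately show ?thesis
    using convex_hull_Int_hyperplane_eq_segment[of "vc 0 1" "vc a 0" "vc (- c) 0" u v] assms
    unfolding compatible_def by simp
qed

lemma eventually_affine_pos:
  assumes "A > (0::real)"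
  shows "\<forall>\<^sub>F t in at_right 0. A + t * B > 0"
proof -
  have "((\<lambda>t. A + t * B) \<longlongrightarrow> A + 0 * B) (at_right 0)"
    by (intro tendsto_intros)
  then show ?thesis using assms by (intro order_tendstoD(1)[where y=A]) auto
qed

text \<open>As the lower vertex shrinks to the origin, so does the crossing point of the segment
  from \<open>u\<close>; both inequalities of \<open>compatibleI\<close> are affine in
  \<open>t\<close> and strict at \<open>t = 0\<close>.\<close>

lemma eventually_compatible:
  assumes "a > 0" "c > 0" "u $ 2 > 0" "w $ 2 < 0"
  shows "\<forall>\<^sub>F t in at_right 0. compatible a c u (t *\<^sub>R w)"
proof -
  have "\<forall>\<^sub>F t in at_right 0. c * u $ 2 + t * (w $ 1 * u $ 2 - u $ 1 * w $ 2 - c * w $ 2) > 0"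
    "\<forall>\<^sub>F t in at_right 0. a * u $ 2 + t * (- w $ 1 * u $ 2 + u $ 1 * w $ 2 - a * w $ 2) > 0"
    using assms by (intro eventually_affine_pos; simp)+
  moreover have "\<forall>\<^sub>F t in at_right 0. (0::real) < t" by (rule eventually_at_right_less)
  ultimately show ?thesis
  proof eventually_elim
    case (elim t)
    then show ?case using assms
      by (intro compatibleI) (auto simp: algebra_simps mult_less_0_iff)
  qed
qed

text \<open>The origin is an inner point of the base, so short vertical steps from it towards
  \<open>w\<close> stay in the triangle. Explicitly, \<open>w\<close> gets weight \<open>r\<close>,
  chosen for the height, and a point of the base compensates the horizontal shift.\<close>

lemma eventually_in_triangle:
  assumes "a > 0" "c > 0" "w $ 2 \<noteq> 0"
  shows "\<forall>\<^sub>F t in at_right 0. vc 0 (sgn (w $ 2) * t) \<in> convex hull {vc a 0, vc (- c) 0, w}"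
proof -
  define k where "k = 1 / \<bar>w $ 2\<bar>"
  have k: "k > 0" "k * w $ 2 = sgn (w $ 2)"
    using assms by (auto simp: k_def sgn_if abs_if)
  have "\<forall>\<^sub>F t in at_right 0. 1 + t * (- k) > 0"
    "\<forall>\<^sub>F t in at_right 0. c + t * (- c * k - k * w $ 1) > 0"
    "\<forall>\<^sub>F t in at_right 0. a + t * (- a * k + k * w $ 1) > 0"
    using assms by (intro eventually_affine_pos; simp)+
  moreover have "\<forall>\<^sub>F t in at_right 0. (0::real) < t" by (rule eventually_at_right_less)
  ultimately show ?thesis
  proof eventually_elim
    case (elim t)
    define r where "r = t * k"
    have r: "0 \<le> r" "r < 1" "c * (1 - r) - r * w $ 1 > 0" "a * (1 - r) + r * w $ 1 > 0"
      using elim k by (auto simp: r_def algebra_simps)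
    have "vc (- r * w $ 1 / (1 - r)) 0 \<in> convex hull {vc a 0, vc (- c) 0}"
      using assms r by (intro vc_0_in_segment) (auto simp: field_simps)
    then have "vc (- r * w $ 1 / (1 - r)) 0 \<in> convex hull {vc a 0, vc (- c) 0, w}"
      using hull_mono[of "{vc a 0, vc (- c) 0}" "{vc a 0, vc (- c) 0, w}" convex] by blast
    then have "(1 - r) *\<^sub>R vc (- r * w $ 1 / (1 - r)) 0 + r *\<^sub>R w \<in> convex hull {vc a 0, vc (- c) 0, w}"
      using r by (intro convexD_alt) (auto intro: hull_inc)
    moreover have "(1 - r) *\<^sub>R vc (- r * w $ 1 / (1 - r)) 0 + r *\<^sub>R w = vc 0 (sgn (w $ 2) * t)"
      using r k by (simp add: vec2_eq_iff) (metis r_def mult.assoc mult.commute)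
    ultimately show ?case by simp
  qed
qed

lemma eventually_at_right_0_ex:
  assumes "\<forall>\<^sub>F t in at_right (0::real). Q t"
  shows "\<exists>t>0. Q t"
  using eventually_happens[OF eventually_conj[OF eventually_at_right_less assms]] by auto

text \<open>The matrix fixes the horizontal axis pointwise and preserves both open half
  planes.\<close>

lemma compatible_shear:
  assumes "compatible a c u v" "t > 0" "a > 0" "c > 0"
  shows "compatible a c (mat2 1 x 0 t *v u) (mat2 1 x 0 t *v v)"
proof -
  let ?f = "(*v) (mat2 1 x 0 t)"
  let ?S = "{vc a 0, vc (- c) 0, u, v}"
  have nth: "(?f w) $ 1 = w $ 1 + x * w $ 2" "(?f w) $ 2 = t * w $ 2" for w
    by (simp_all add: matrix_vector_mult_def sum_2)
  have im: "?f ` ?S = {vc a 0, vc (- c) 0, ?f u, ?f v}" by simp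
  have "convex hull {vc a 0, vc (- c) 0, ?f u, ?f v} \<inter> {x. x $ 2 = 0} \<subseteq> convex hull {vc a 0, vc (- c) 0}"
  proof
    fix y assume y: "y \<in> convex hull {vc a 0, vc (- c) 0, ?f u, ?f v} \<inter> {x. x $ 2 = 0}"
    then obtain z where z: "z \<in> convex hull ?S" "y = ?f z"
      using convex_hull_linear_image[OF matrix_vector_mul_linear[of "mat2 1 x 0 t"], of ?S] im by auto
    then have z2: "z $ 2 = 0" using y nth assms by auto
    then have "z \<in> convex hull {vc a 0, vc (- c) 0}"
      using assms z unfolding compatible_def by blast
    moreover have "y = z" using z z2 nth by (simp add: vec2_eq_iff)
    ultimately show "y \<in> convex hull {vc a 0, vc (- c) 0}" by simp
  qed
  moreover have "convex hull {vc a 0, vc (- c) 0} \<subseteq> convex hull {vc a 0, vc (- c) 0, ?f u, ?f v} \<inter> {x. x $ 2 = 0}"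
  proof -
    have "convex hull {vc a 0, vc (- c) 0} \<subseteq> {x. vc 0 1 \<bullet> x = 0}"
      by (intro hull_minimal convex_hyperplane) auto
    moreover have "convex hull {vc a 0, vc (- c) 0} \<subseteq> convex hull {vc a 0, vc (- c) 0, ?f u, ?f v}"
      by (intro hull_mono) auto
    ultimately show ?thesis by auto
  qed
  ultimately show ?thesis
    using assms nth unfolding compatible_def by (auto simp: mult_pos_neg)
qed

text \<open>No regularity of \<open>f\<close> is needed: computing \<open>f (s * x) 1\<close> in two ways gives
  \<open>(x\<^sup>2 - 1) * f s 1 = (s\<^sup>2 - 1) * f x 1\<close>.\<close>

lemma additive_homogeneous2:
  fixes f :: "real \<Rightarrow> real \<Rightarrow> real"
  assumes add: "\<And>a c e. a > 0 \<Longrightarrow> c > 0 \<Longrightarrow> e > 0 \<Longrightarrow> f a c = f a e + f e c"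
    and hom: "\<And>a c s. a > 0 \<Longrightarrow> c > 0 \<Longrightarrow> s > 0 \<Longrightarrow> f (s * a) (s * c) = s * s * f a c"
    and "a > 0" "c > 0"
  shows "f a c = (a * a - c * c) / 3 * f 2 1"
proof -
  have mul: "f (s * x) 1 = s * s * f x 1 + f s 1" if "s > 0" "x > 0" for s x
    using add[of "s * x" 1 s] hom[of x 1 s] that by simp
  have e: "f x 1 = (x * x - 1) / 3 * f 2 1" if "x > 0" for x
  proof -
    have "x * x * f 2 1 + f x 1 = 2 * 2 * f x 1 + f 2 1"
      using mul[of x 2] mul[of 2 x] that by (simp only: mult.commute[of 2 x])
    then show ?thesis by (simp add: algebra_simps)
  qed
  have "f a c = c * c * f (a / c) 1"
    using hom[of "a / c" 1 c] assms(3,4) by simp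
  also have "\<dots> = c * c * ((a / c * (a / c) - 1) / 3 * f 2 1)"
    using e[of "a / c"] assms(3,4) by simp
  also have "\<dots> = (a * a - c * c) / 3 * f 2 1"
    using assms(4) by (simp add: field_simps)
  finally show ?thesis .
qed

section \<open>Symmetries and exchange identities of double pyramids\<close>

context covariant_valuation
begin

abbreviation D :: "real \<Rightarrow> real \<Rightarrow> real \<Rightarrow> real \<Rightarrow> real^2^2" where
  "D a b c d \<equiv> \<nu> (double_pyramid a b c d)"

lemma D_scale:
  assumes "a > 0" "b > 0" "c > 0" "d > 0" "s > 0" "t > 0"
  shows "D (s * a) (t * b) (s * c) (t * d) $ 1 $ 1 = s * s * s * t * D a b c d $ 1 $ 1"
    and "D (s * a) (t * b) (s * c) (t * d) $ 1 $ 2 = s * s * (t * t) * D a b c d $ 1 $ 2"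
proof -
  have "(*v) (mat2 s 0 0 t) ` {vc a 0, vc (- c) 0, vc 0 b, vc 0 (- d)} =
      {vc (s * a) 0, vc (- (s * c)) 0, vc 0 (t * b), vc 0 (- (t * d))}" by simp
  then have "D (s * a) (t * b) (s * c) (t * d) =
      \<bar>s * t\<bar> *\<^sub>R (mat2 s 0 0 t ** D a b c d ** transpose (mat2 s 0 0 t))"
    using transform[of "{vc a 0, vc (- c) 0, vc 0 b, vc 0 (- d)}" s t 0 0] assms double_pyramid_in_polygons_o
    unfolding double_pyramid_def by simp
  then show "D (s * a) (t * b) (s * c) (t * d) $ 1 $ 1 = s * s * s * t * D a b c d $ 1 $ 1"
    and "D (s * a) (t * b) (s * c) (t * d) $ 1 $ 2 = s * s * (t * t) * D a b c d $ 1 $ 2"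
    using assms by (simp_all add: congruence_mat2_nth)
qed

lemma D_reflect:
  assumes "a > 0" "b > 0" "c > 0" "d > 0"
  shows "D c b a d $ 1 $ 1 = D a b c d $ 1 $ 1"
    and "D c b a d $ 1 $ 2 = - D a b c d $ 1 $ 2"
proof -
  have "(*v) (mat2 (-1) 0 0 1) ` {vc a 0, vc (- c) 0, vc 0 b, vc 0 (- d)} =
      {vc c 0, vc (- a) 0, vc 0 b, vc 0 (- d)}" by auto
  then have "D c b a d = mat2 (-1) 0 0 1 ** D a b c d ** transpose (mat2 (-1) 0 0 1)"
    using transform[of "{vc a 0, vc (- c) 0, vc 0 b, vc 0 (- d)}" "-1" 1 0 0] assms double_pyramid_in_polygons_o
    unfolding double_pyramid_def by simp
  then show "D c b a d $ 1 $ 1 = D a b c d $ 1 $ 1" "D c b a d $ 1 $ 2 = - D a b c d $ 1 $ 2"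
    by (simp_all add: congruence_mat2_nth)
qed

lemma D_reflect2:
  assumes "a > 0" "b > 0" "c > 0" "d > 0"
  shows "D a d c b $ 1 $ 1 = D a b c d $ 1 $ 1"
    and "D a d c b $ 1 $ 2 = - D a b c d $ 1 $ 2"
proof -
  have "(*v) (mat2 1 0 0 (-1)) ` {vc a 0, vc (- c) 0, vc 0 b, vc 0 (- d)} =
      {vc a 0, vc (- c) 0, vc 0 d, vc 0 (- b)}" by auto
  then have "D a d c b = mat2 1 0 0 (-1) ** D a b c d ** transpose (mat2 1 0 0 (-1))"
    using transform[of "{vc a 0, vc (- c) 0, vc 0 b, vc 0 (- d)}" 1 "-1" 0 0] assms double_pyramid_in_polygons_o
    unfolding double_pyramid_def by simp
  then show "D a d c b $ 1 $ 1 = D a b c d $ 1 $ 1" "D a d c b $ 1 $ 2 = - D a b c d $ 1 $ 2"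
    by (simp_all add: congruence_mat2_nth)
qed

lemma D_swap:
  assumes "a > 0" "b > 0" "c > 0" "d > 0"
  shows "D b a d c $ 1 $ 1 = D a b c d $ 2 $ 2" "D b a d c $ 1 $ 2 = D a b c d $ 2 $ 1"
    "D b a d c $ 2 $ 1 = D a b c d $ 1 $ 2" "D b a d c $ 2 $ 2 = D a b c d $ 1 $ 1"
proof -
  have "(*v) (mat2 0 1 1 0) ` {vc a 0, vc (- c) 0, vc 0 b, vc 0 (- d)} =
      {vc b 0, vc (- d) 0, vc 0 a, vc 0 (- c)}" by auto
  then have "D b a d c = mat2 0 1 1 0 ** D a b c d ** transpose (mat2 0 1 1 0)"
    using transform[of "{vc a 0, vc (- c) 0, vc 0 b, vc 0 (- d)}" 0 0 1 1] assms double_pyramid_in_polygons_o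
    unfolding double_pyramid_def by simp
  then show "D b a d c $ 1 $ 1 = D a b c d $ 2 $ 2" "D b a d c $ 1 $ 2 = D a b c d $ 2 $ 1"
    "D b a d c $ 2 $ 1 = D a b c d $ 1 $ 2" "D b a d c $ 2 $ 2 = D a b c d $ 1 $ 1"
    by (simp_all add: congruence_mat2_nth)
qed

text \<open>The kite is cut along its vertical diagonal; since the origin lies on this diagonal, the
  shorter horizontal arms end inside the triangles over the longer ones.\<close>

lemma D_exchange_nested:
  assumes "b > 0" "d > 0" "0 < a'" "a' \<le> a" "0 < c'" "c' \<le> c"
  shows "D a b c d + D a' b c' d = D a b c' d + D a' b c d"
proof -
  have 0: "0 \<in> convex hull {vc 0 b, vc 0 (- d)}"
  proof -
    have "0 = (1 - b / (b + d)) *\<^sub>R vc 0 b + (b / (b + d)) *\<^sub>R vc 0 (- d)"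
      using assms by (simp add: zero_vc field_simps)
    moreover have "0 \<le> b / (b + d)" "b / (b + d) \<le> 1" using assms by auto
    ultimately show ?thesis
      unfolding segment_convex_hull[symmetric] in_segment by blast
  qed
  have e: "double_pyramid x b y d = convex hull {vc 0 b, vc 0 (- d), vc x 0, vc (- y) 0}" for x y
    unfolding double_pyramid_def by (simp add: insert_commute)
  have h: "convex hull {vc 0 b, vc 0 (- d), vc a 0, vc (- c) 0} \<inter> {x. vc 1 0 \<bullet> x = 0} = convex hull {vc 0 b, vc 0 (- d)}"
    using assms 0 by (intro convex_hull_Int_hyperplane_eq_segment) (auto simp: zero_vc)
  have u1: "vc a' 0 \<in> convex hull {vc 0 b, vc 0 (- d), vc a 0}"
    using scaleR_in_convex_hull[OF 0, of "a' / a" "vc a 0"] assms by (simp add: insert_commute)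
  have v1: "vc (- c') 0 \<in> convex hull {vc 0 b, vc 0 (- d), vc (- c) 0}"
    using scaleR_in_convex_hull[OF 0, of "c' / c" "vc (- c) 0"] assms by (simp add: insert_commute)
  show ?thesis
    unfolding e
    by (rule kite_exchange[OF _ _ _ _ _ h u1 _ v1]) (use assms in \<open>auto simp: e[symmetric] intro: double_pyramid_in_polygons_o\<close>)
qed

text \<open>Interchanging \<open>a\<close> with \<open>a'\<close>, or \<open>c\<close> with
  \<open>c'\<close>, merely swaps the two sides of the identity, so the nested case
  suffices.\<close>

lemma D_exchange1:
  assumes "a > 0" "b > 0" "c > 0" "d > 0" "a' > 0" "c' > 0"
  shows "D a b c d + D a' b c' d = D a b c' d + D a' b c d"
proof -
  consider "a' \<le> a" "c' \<le> c" | "a' \<le> a" "c \<le> c'" | "a \<le> a'" "c' \<le> c" | "a \<le> a'" "c \<le> c'" by linarith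
  then show ?thesis
  proof cases
    case 1 then show ?thesis using D_exchange_nested assms by blast
  next
    case 2 then show ?thesis using D_exchange_nested[of b d a' a c c'] assms by simp
  next
    case 3 then show ?thesis using D_exchange_nested[of b d a a' c' c] assms by (simp add: add.commute)
  next
    case 4 then show ?thesis using D_exchange_nested[of b d a a' c c'] assms by (simp add: add.commute)
  qed
qed

lemma D_exchange2:
  assumes "a > 0" "b > 0" "c > 0" "d > 0" "b' > 0" "d' > 0"
  shows "D a b c d + D a b' c d' = D a b c d' + D a b' c d"
  using D_exchange1[of b a d c b' d'] assms D_swap[of a b c d] D_swap[of a b' c d'] D_swap[of a b c d'] D_swap[of a b' c d]
  by (simp add: mat22_eq_iff)

end

locale null_valuation = covariant_valuation +
  assumes D_unit: "D 1 1 1 1 $ 1 $ 1 = 0"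
begin

text \<open>A pyramid and its mirror image have the same entry, and the exchange identity turns
  their sum into a sum of two pyramids with one more mirror symmetry. Doing this for both axes leads
  to rhombi, which are images of the unit square under diagonal matrices.\<close>

lemma D_11: 
  assumes "a > 0" "b > 0" "c > 0" "d > 0"
  shows "D a b c d $ 1 $ 1 = 0"
proof -
  have sym0: "D x y x y $ 1 $ 1 = 0" if "x > 0" "y > 0" for x y
    using D_scale(1)[of 1 1 1 1 x y] that D_unit by simp
  have half: "D x b x d $ 1 $ 1 = 0" if "x > 0" for x
    using arg_cong[OF D_exchange2[of x b x d d b], of "\<lambda>M. M $ 1 $ 1"] D_reflect2(1)[of x b x d] sym0[of x b] sym0[of x d] that assms
    by simp
  show ?thesis
    using arg_cong[OF D_exchange1[of a b c d c a], of "\<lambda>M. M $ 1 $ 1"] D_reflect(1)[of a b c d] half[of a] half[of c] assms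
    by simp
qed

text \<open>The divisor is (2*2 - 1*1) * (2*2 - 1*1), the value at (2, 2, 1, 1) of the expression
  that \<open>\<kappa>\<close> multiplies.\<close>

definition \<kappa> :: real where "\<kappa> = D 2 2 1 1 $ 1 $ 2 / 9"

text \<open>A reflection negates this entry, so it vanishes when the two arms on an axis agree.
  Exchanging with equal arms \<open>e\<close> therefore gives the additivity required by
  \<open>additive_homogeneous2\<close>, which is applied once for each axis.\<close>

lemma D_12:
  assumes "a > 0" "b > 0" "c > 0" "d > 0"
  shows "D a b c d $ 1 $ 2 = \<kappa> * (a * a - c * c) * (b * b - d * d)"
proof -
  have diag: "D x y x w $ 1 $ 2 = 0" if "x > 0" "y > 0" "w > 0" for x y w
    using D_reflect(2)[of x y x w] that by simp
  have diag2: "D x y z y $ 1 $ 2 = 0" if "x > 0" "y > 0" "z > 0" for x y z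
    using D_reflect2(2)[of x y z y] that by simp
  have 1: "D a b c d $ 1 $ 2 = (a * a - c * c) / 3 * D 2 b 1 d $ 1 $ 2"
  proof (rule additive_homogeneous2[of "\<lambda>a c. D a b c d $ 1 $ 2"])
    show "D x b y d $ 1 $ 2 = D x b e d $ 1 $ 2 + D e b y d $ 1 $ 2" if "x > 0" "y > 0" "e > 0" for x y e
      using arg_cong[OF D_exchange1[of x b y d e e], of "\<lambda>M. M $ 1 $ 2"] diag that assms by simp
    show "D (s * x) b (s * y) d $ 1 $ 2 = s * s * D x b y d $ 1 $ 2" if "x > 0" "y > 0" "s > 0" for x y s
      using D_scale(2)[of x b y d s 1] that assms by simp
  qed (use assms in auto)
  have 2: "D 2 b 1 d $ 1 $ 2 = (b * b - d * d) / 3 * D 2 2 1 1 $ 1 $ 2"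
  proof (rule additive_homogeneous2[of "\<lambda>b d. D 2 b 1 d $ 1 $ 2"])
    show "D 2 x 1 y $ 1 $ 2 = D 2 x 1 e $ 1 $ 2 + D 2 e 1 y $ 1 $ 2" if "x > 0" "y > 0" "e > 0" for x y e
      using arg_cong[OF D_exchange2[of 2 x 1 y e e], of "\<lambda>M. M $ 1 $ 2"] diag2 that assms by simp
    show "D 2 (s * x) 1 (s * y) $ 1 $ 2 = s * s * D 2 x 1 y $ 1 $ 2" if "x > 0" "y > 0" "s > 0" for x y s
      using D_scale(2)[of 2 x 1 y 1 s] that assms by simp
  qed (use assms in auto)
  show ?thesis using 1 2 by (simp add: \<kappa>_def)
qed

lemma D_eq:
  assumes "a > 0" "b > 0" "c > 0" "d > 0"
  defines "k \<equiv> \<kappa> * (a * a - c * c) * (b * b - d * d)"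
  shows "D a b c d = mat2 0 k k 0"
  using D_11[of a b c d] D_11[of b a d c] D_12[of a b c d] D_12[of b a d c] D_swap[of a b c d] assms
  by (simp add: mat22_eq_iff mult.commute mult.left_commute)

end

section \<open>Kites\<close>

context covariant_valuation
begin

abbreviation F :: "real \<Rightarrow> real \<Rightarrow> real^2 \<Rightarrow> real^2 \<Rightarrow> real^2^2" where
  "F a c u v \<equiv> \<nu> (convex hull {vc a 0, vc (- c) 0, u, v})"

lemma F_exchange:
  assumes ac: "a > 0" "c > 0" and comp: "compatible a c u v"
    and u1: "u1 \<in> convex hull {vc a 0, vc (- c) 0, u}" "u1 $ 2 > 0"
    and v1: "v1 \<in> convex hull {vc a 0, vc (- c) 0, v}" "v1 $ 2 < 0"
  shows "F a c u v + F a c u1 v1 = F a c u v1 + F a c u1 v"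
proof (rule kite_exchange[where n = "vc 0 1"])
  show "convex hull {vc a 0, vc (- c) 0, u, v} \<in> polygons_o" "convex hull {vc a 0, vc (- c) 0, u1, v1} \<in> polygons_o"
    using assms by (auto intro!: kite_in_polygons_o simp: compatible_def)
qed (use assms in \<open>auto simp: compatible_def\<close>)

text \<open>Choose \<open>vc 0 s\<close> in both upper triangles and \<open>vc 0 (- t)\<close> in
  both lower ones. Exchanging with these two points splits each of the four values into an upper and
  a lower term, and the lower terms cancel.\<close>

lemma F_diff_indep:
  assumes ac: "a > 0" "c > 0"
    and comp: "compatible a c u v" "compatible a c u0 v" "compatible a c u v'" "compatible a c u0 v'"
  shows "F a c u v - F a c u0 v = F a c u v' - F a c u0 v'"
proof -
  have pos: "u $ 2 > 0" "u0 $ 2 > 0" "v $ 2 < 0" "v' $ 2 < 0"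
    using comp by (auto simp: compatible_def)
  have "\<forall>\<^sub>F t in at_right 0. vc 0 (sgn (u $ 2) * t) \<in> convex hull {vc a 0, vc (- c) 0, u} \<and>
      vc 0 (sgn (u0 $ 2) * t) \<in> convex hull {vc a 0, vc (- c) 0, u0}"
    using ac pos by (intro eventually_conj eventually_in_triangle) auto
  then obtain s where s: "s > 0" "vc 0 s \<in> convex hull {vc a 0, vc (- c) 0, u}" "vc 0 s \<in> convex hull {vc a 0, vc (- c) 0, u0}"
    using pos by (auto dest!: eventually_at_right_0_ex)
  have "\<forall>\<^sub>F t in at_right 0. vc 0 (sgn (v $ 2) * t) \<in> convex hull {vc a 0, vc (- c) 0, v} \<and>
      vc 0 (sgn (v' $ 2) * t) \<in> convex hull {vc a 0, vc (- c) 0, v'}"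
    using ac pos by (intro eventually_conj eventually_in_triangle) auto
  then obtain t where t: "t > 0" "vc 0 (- t) \<in> convex hull {vc a 0, vc (- c) 0, v}" "vc 0 (- t) \<in> convex hull {vc a 0, vc (- c) 0, v'}"
    using pos by (auto dest!: eventually_at_right_0_ex)
  have "F a c u v + F a c (vc 0 s) (vc 0 (- t)) = F a c u (vc 0 (- t)) + F a c (vc 0 s) v"
    "F a c u0 v + F a c (vc 0 s) (vc 0 (- t)) = F a c u0 (vc 0 (- t)) + F a c (vc 0 s) v"
    "F a c u v' + F a c (vc 0 s) (vc 0 (- t)) = F a c u (vc 0 (- t)) + F a c (vc 0 s) v'"
    "F a c u0 v' + F a c (vc 0 s) (vc 0 (- t)) = F a c u0 (vc 0 (- t)) + F a c (vc 0 s) v'"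
    by (rule F_exchange[OF ac]; use comp s t in simp)+
  then show ?thesis by (auto simp: mat22_eq_iff)
qed

text \<open>The upper half of a kite contributes \<open>X\<close>, up to a term depending only on the lower half.
  Only differences of values of \<open>X\<close> are meaningful.\<close>

definition X :: "real \<Rightarrow> real \<Rightarrow> real^2 \<Rightarrow> real^2^2" where
  "X a c u = (let v = SOME v. compatible a c u v \<and> compatible a c (vc 0 1) v in F a c u v - F a c (vc 0 1) v)"

lemma common_compatible:
  assumes "a > 0" "c > 0" "finite A" "\<And>u. u \<in> A \<Longrightarrow> u $ 2 > 0"
  shows "\<exists>v. \<forall>u\<in>A. compatible a c u v"
proof -
  have "\<forall>\<^sub>F t in at_right 0. \<forall>u\<in>A. compatible a c u (t *\<^sub>R vc 0 (-1))"
    using assms by (intro eventually_ball_finite ballI eventually_compatible) auto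
  then show ?thesis by (auto dest!: eventually_at_right_0_ex)
qed

text \<open>All differences are transported to one lower vertex \<open>v'\<close> compatible with
  \<open>u\<close>, \<open>u0\<close> and the reference point \<open>vc 0 1\<close>; by
  \<open>F_diff_indep\<close> the choice made inside \<open>X\<close> does not matter.\<close>

lemma X_diff:
  assumes ac: "a > 0" "c > 0" and comp: "compatible a c u v" "compatible a c u0 v"
  shows "F a c u v - F a c u0 v = X a c u - X a c u0"
proof -
  have pos: "u $ 2 > 0" "u0 $ 2 > 0" using comp by (auto simp: compatible_def)
  obtain v' where v': "compatible a c u v'" "compatible a c u0 v'" "compatible a c (vc 0 1) v'"
    using common_compatible[OF ac, of "{u, u0, vc 0 1}"] pos by force
  have X: "X a c w = F a c w v' - F a c (vc 0 1) v'" if "compatible a c w v'" for w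
  proof -
    define z where "z = (SOME v. compatible a c w v \<and> compatible a c (vc 0 1) v)"
    have "compatible a c w z \<and> compatible a c (vc 0 1) z"
      unfolding z_def by (rule someI[where x = v']) (use that v' in simp)
    then have "F a c w z - F a c (vc 0 1) z = F a c w v' - F a c (vc 0 1) v'"
      using F_diff_indep[OF ac, of w z "vc 0 1" v'] that v' by blast
    then show ?thesis by (simp add: X_def z_def)
  qed
  show ?thesis
    using X[OF v'(1)] X[OF v'(2)] F_diff_indep[OF ac comp v'(1,2)] by simp
qed

lemma F_shear:
  assumes "a > 0" "c > 0" "u $ 2 > 0" "v $ 2 < 0" "t > 0"
  shows "F a c (mat2 1 x 0 t *v u) (mat2 1 x 0 t *v v) =
    t *\<^sub>R (mat2 1 x 0 t ** F a c u v ** transpose (mat2 1 x 0 t))"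
  using transform[of "{vc a 0, vc (- c) 0, u, v}" 1 t x 0] assms kite_in_polygons_o by simp

lemma X_shear:
  assumes ac: "a > 0" "c > 0" and pos: "u $ 2 > 0" "u0 $ 2 > 0" and t: "t > 0"
  shows "X a c (mat2 1 x 0 t *v u) - X a c (mat2 1 x 0 t *v u0) =
    t *\<^sub>R (mat2 1 x 0 t ** (X a c u - X a c u0) ** transpose (mat2 1 x 0 t))"
proof -
  let ?\<phi> = "mat2 1 x 0 t"
  obtain v where v: "compatible a c u v" "compatible a c u0 v"
    using common_compatible[OF ac, of "{u, u0}"] pos by force
  then have v2: "v $ 2 < 0" by (simp add: compatible_def)
  have "X a c (?\<phi> *v u) - X a c (?\<phi> *v u0) = F a c (?\<phi> *v u) (?\<phi> *v v) - F a c (?\<phi> *v u0) (?\<phi> *v v)"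
    using X_diff[OF ac compatible_shear compatible_shear] v t ac by simp
  also have "\<dots> = t *\<^sub>R (?\<phi> ** (F a c u v - F a c u0 v) ** transpose ?\<phi>)"
    using F_shear[OF ac _ v2 t] pos by (simp add: mat22_eq_iff congruence_mat2_nth algebra_simps)
  also have "F a c u v - F a c u0 v = X a c u - X a c u0"
    by (rule X_diff[OF ac v])
  finally show ?thesis .
qed

end

context null_valuation
begin

text \<open>The upper part of \<open>D_eq\<close> carried along by shears: on the vertical axis it
  is the off-diagonal matrix, and the shear with ratio \<open>x = u $ 1 / u $ 2\<close> adds the
  corner entry \<open>2 * x * (u $ 2 * u $ 2)\<close>.\<close>

definition G :: "real \<Rightarrow> real \<Rightarrow> real^2 \<Rightarrow> real^2^2" where
  "G a c u = (\<kappa> * (a * a - c * c)) *\<^sub>R mat2 (2 * u $ 1 * u $ 2) (u $ 2 * u $ 2) (u $ 2 * u $ 2) 0"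

text \<open>The segment from \<open>s *\<^sub>R u\<close> to \<open>- u\<close> passes through the
  origin, so a shear fixing the horizontal axis straightens this kite to a double pyramid.\<close>

lemma F_ray:
  assumes "a > 0" "c > 0" "u $ 2 > 0" "s > 0"
  shows "F a c (s *\<^sub>R u) (- u) = G a c (s *\<^sub>R u) - G a c u"
proof -
  define x y where "x = u $ 1 / u $ 2" and "y = u $ 2"
  have y: "y > 0" and u: "u = vc (x * y) y" using assms vc_eta[of u] by (simp_all add: x_def y_def)
  define k where "k = \<kappa> * (a * a - c * c) * (s * y * (s * y) - y * y)"
  have "F a c (vc 0 (s * y)) (vc 0 (- y)) = mat2 0 k k 0"
    using D_eq[of a "s * y" c y] assms y by (simp add: double_pyramid_def k_def)
  then have "F a c (s *\<^sub>R u) (- u) = mat2 1 x 0 1 ** mat2 0 k k 0 ** transpose (mat2 1 x 0 1)"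
    using F_shear[of a c "vc 0 (s * y)" "vc 0 (- y)" 1 x] assms y by (simp add: u mult.left_commute)
  then show ?thesis
    by (simp add: u G_def mat22_eq_iff congruence_mat2_nth k_def) (simp add: algebra_simps)
qed

definition X' :: "real \<Rightarrow> real \<Rightarrow> real^2 \<Rightarrow> real^2^2" where
  "X' a c u = X a c u - G a c u"

text \<open>The lower vertex \<open>- u\<close> is compatible with all positive multiples of
  \<open>u\<close>, and for these kites \<open>F_ray\<close> says that \<open>G\<close> accounts for
  the whole variation.\<close>

lemma X'_ray:
  assumes ac: "a > 0" "c > 0" and u: "u $ 2 > 0" and s: "s > 0"
  shows "X' a c (s *\<^sub>R u) = X' a c u"
proof -
  have "compatible a c (r *\<^sub>R u) (- u)" if "r > 0" for r
    using ac u that by (intro compatibleI) (auto simp: mult_nonpos_nonneg)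
  from this[of s] this[of 1] have "compatible a c (s *\<^sub>R u) (- u)" "compatible a c u (- u)" using s by auto
  then have "X a c (s *\<^sub>R u) - X a c u = F a c (s *\<^sub>R u) (- u) - F a c u (- u)"
    using X_diff[OF ac] by simp
  then show ?thesis
    using F_ray[OF ac u s] F_ray[OF ac u, of 1] by (simp add: X'_def algebra_simps)
qed

lemma X'_shear:
  assumes "a > 0" "c > 0" "u $ 2 > 0" "u0 $ 2 > 0" "t > 0"
  shows "X' a c (mat2 1 x 0 t *v u) - X' a c (mat2 1 x 0 t *v u0) =
    t *\<^sub>R (mat2 1 x 0 t ** (X' a c u - X' a c u0) ** transpose (mat2 1 x 0 t))"
proof -
  have "G a c (mat2 1 x 0 t *v w) = t *\<^sub>R (mat2 1 x 0 t ** G a c w ** transpose (mat2 1 x 0 t))" for w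
    by (simp add: G_def mat22_eq_iff congruence_mat2_nth matrix_vector_mult_def sum_2 algebra_simps)
  then show ?thesis
    using X_shear[OF assms, of x] by (simp add: X'_def mat22_eq_iff congruence_mat2_nth algebra_simps)
qed

text \<open>The difference \<open>g x\<close> satisfies a cocycle equation under shears and scales under
  \<open>mat2 1 0 0 (1/2)\<close>; comparing both expressions for \<open>g (2 * x)\<close> forces \<open>g = 0\<close>.\<close>

lemma X'_const:
  assumes ac: "a > 0" "c > 0" and u: "u $ 2 > 0"
  shows "X' a c u = X' a c (vc 0 1)"
proof -
  define g where "g x = X' a c (vc x 1) - X' a c (vc 0 1)" for x
  have g0: "g x = 0" for x
  proof -
    have 1: "g (2 * x) - g x = mat2 1 x 0 1 ** g x ** transpose (mat2 1 x 0 1)"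
      using X'_shear[OF ac, of "vc x 1" "vc 0 1" 1 x] by (simp add: g_def)
    have "X' a c (vc x (1/2)) = X' a c (vc (2 * x) 1)" "X' a c (vc 0 (1/2)) = X' a c (vc 0 1)"
      using X'_ray[OF ac, of "vc (2 * x) 1" "1/2"] X'_ray[OF ac, of "vc 0 1" "1/2"] by simp_all
    then have 2: "g (2 * x) = (1/2) *\<^sub>R (mat2 1 0 0 (1/2) ** g x ** transpose (mat2 1 0 0 (1/2)))"
      using X'_shear[OF ac, of "vc x 1" "vc 0 1" "1/2" 0] by (simp add: g_def)
    \<comment> \<open>On this entry the cocycle equation gives the factor 2 and the scaling the
      factor 1/8; for the off-diagonal entries it is 2 against 1/4, for the corner 2 against 1/2.
      The order matters, since the shear mixes the later entries with the earlier ones.\<close>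
    have e22: "g x $ 2 $ 2 = 0"
      using 1 2 by (simp add: mat22_eq_iff congruence_mat2_nth)
    then have e12: "g x $ 1 $ 2 = 0" "g x $ 2 $ 1 = 0"
      using 1 2 by (simp_all add: mat22_eq_iff congruence_mat2_nth)
    then have "g x $ 1 $ 1 = 0"
      using 1 2 e22 by (simp add: mat22_eq_iff congruence_mat2_nth)
    then show ?thesis using e22 e12 by (simp add: mat22_eq_iff)
  qed
  have "X' a c u = X' a c (vc (u $ 1 / u $ 2) 1)"
    using X'_ray[OF ac, of "vc (u $ 1 / u $ 2) 1" "u $ 2"] u vc_eta[of u] by simp
  then show ?thesis using g0[of "u $ 1 / u $ 2"] by (simp add: g_def)
qed

text \<open>Compare with the upper vertex \<open>- v\<close>: that kite has value 0 by
  \<open>F_ray\<close>, the remainder \<open>X'\<close> does not see the change of vertex, and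
  \<open>G\<close> is even.\<close>

lemma F_eq:
  assumes ac: "a > 0" "c > 0" and comp: "compatible a c u v"
  shows "F a c u v = G a c u - G a c v"
proof -
  have uv: "u $ 2 > 0" "v $ 2 < 0" using comp by (auto simp: compatible_def)
  have "compatible a c (- v) v"
    using ac uv by (intro compatibleI) (auto simp: mult_nonneg_nonpos mult.commute)
  then have "F a c u v - F a c (- v) v = X a c u - X a c (- v)"
    using X_diff[OF ac comp] by blast
  moreover have "X' a c u = X' a c (- v)"
    using X'_const[OF ac, of u] X'_const[OF ac, of "- v"] uv by simp
  moreover have "F a c (- v) v = 0"
    using F_ray[OF ac, of "- v" 1] uv by simp
  moreover have "G a c (- v) = G a c v" by (simp add: G_def)
  ultimately show ?thesis by (auto simp: X'_def mat22_eq_iff)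
qed

text \<open>The horizontal axis cuts the triangle from \<open>vc 1 0\<close> to the midpoint of the
  opposite edge, so it is a degenerate kite. There \<open>F_eq\<close> gives the diagonal entries
  \<open>- (3/2) * \<kappa>\<close> and 0, which the interchange of coordinates forces to be
  equal.\<close>

lemma \<kappa>_zero: "\<kappa> = 0"
proof -
  let ?T = "{vc 1 0, vc 0 1, vc (-1) (-1)}"
  have "vc (-1/2) 0 \<in> convex hull {vc 0 1, vc (-1) (-1)}"
    unfolding segment_convex_hull[symmetric] in_segment by (rule exI[of _ "1/2"]) simp
  then have "vc (-1/2) 0 \<in> convex hull ?T"
    using hull_mono[of "{vc 0 1, vc (-1) (-1)}" ?T convex] by blast
  then have T: "convex hull {vc 1 0, vc (- (1/2)) 0, vc 0 1, vc (-1) (-1)} = convex hull ?T"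
    using hull_redundant[of "vc (-1/2) 0" convex ?T] by (simp add: insert_commute)
  have po: "convex hull ?T \<in> polygons_o"
    using kite_in_polygons_o[of 1 "1/2" "vc 0 1" "vc (-1) (-1)"] T by simp
  have "(*v) (mat2 0 1 1 0) ` ?T = ?T" by auto
  then have "\<nu> (convex hull ?T) = mat2 0 1 1 0 ** \<nu> (convex hull ?T) ** transpose (mat2 0 1 1 0)"
    using transform[of ?T 0 0 1 1] po by (simp only: simp_thms) simp
  from arg_cong[OF this, of "\<lambda>M. M $ 1 $ 1"]
  have eq: "\<nu> (convex hull ?T) $ 1 $ 1 = \<nu> (convex hull ?T) $ 2 $ 2"
    unfolding congruence_mat2_nth by simp
  have "compatible 1 (1/2) (vc 0 1) (vc (-1) (-1))"
    by (intro compatibleI) auto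
  then have "\<nu> (convex hull ?T) = G 1 (1/2) (vc 0 1) - G 1 (1/2) (vc (-1) (-1))"
    using F_eq[of 1 "1/2" "vc 0 1" "vc (-1) (-1)"] T by simp
  then show ?thesis using eq by (simp add: G_def)
qed

lemma F_zero:
  assumes "a > 0" "c > 0" "compatible a c u v"
  shows "F a c u v = 0"
  using F_eq[OF assms] \<kappa>_zero by (simp add: G_def)

text \<open>The transfer of \<open>F_zero\<close> to a diagonal in any direction \<open>p\<close>.
  The points of \<open>E\<close> may be arbitrary on that line: they are replaced by the two ends of
  the section of the polygon.\<close>

lemma kite_zero:
  assumes P: "convex hull (insert u (insert v E)) \<in> polygons_o" and "p \<noteq> 0"
    and u: "perp p \<bullet> u > 0" and v: "perp p \<bullet> v < 0"
    and E: "\<And>x. x \<in> E \<Longrightarrow> perp p \<bullet> x = 0"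
  shows "\<nu> (convex hull (insert u (insert v E))) = 0"
proof -
  let ?P = "convex hull (insert u (insert v E))"
  obtain a c where ac: "a > 0" "c > 0"
    and line: "?P \<inter> {x. perp p \<bullet> x = 0} = convex hull {a *\<^sub>R p, - (c *\<^sub>R p)}"
    using polygons_o_Int_line[OF P \<open>p \<noteq> 0\<close>] by blast
  have inP: "a *\<^sub>R p \<in> ?P" "- (c *\<^sub>R p) \<in> ?P"
    using line hull_subset[of "{a *\<^sub>R p, - (c *\<^sub>R p)}" convex] by auto
  have "E \<subseteq> ?P" using hull_subset[of "insert u (insert v E)" convex] by blast
  then have EC: "E \<subseteq> convex hull {a *\<^sub>R p, - (c *\<^sub>R p)}" using line E by blast
  have Peq: "?P = convex hull {a *\<^sub>R p, - (c *\<^sub>R p), u, v}"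
  proof
    show "convex hull {a *\<^sub>R p, - (c *\<^sub>R p), u, v} \<subseteq> ?P"
      using inP by (intro hull_minimal convex_convex_hull) (auto intro: hull_inc)
    have "convex hull {a *\<^sub>R p, - (c *\<^sub>R p)} \<subseteq> convex hull {a *\<^sub>R p, - (c *\<^sub>R p), u, v}"
      by (intro hull_mono) auto
    then show "?P \<subseteq> convex hull {a *\<^sub>R p, - (c *\<^sub>R p), u, v}"
      using EC by (intro hull_minimal convex_convex_hull) (auto intro: hull_inc)
  qed
  let ?p = "p $ 1" and ?q = "p $ 2"
  \<comment> \<open>A rotation times a dilation, taking the first basis vector to \<open>p\<close>;
    \<open>i\<close> below is its inverse.\<close>
  let ?\<phi> = "mat2 ?p (- ?q) ?q ?p"
  define N where "N = ?p * ?p + ?q * ?q"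
  have N: "N > 0"
    using \<open>p \<noteq> 0\<close> unfolding N_def by (metis inner_gt_zero_iff inner_real2)
  define i where "i w = vc ((?p * w $ 1 + ?q * w $ 2) / N) ((?p * w $ 2 - ?q * w $ 1) / N)" for w :: "real^2"
  have \<phi>i: "?\<phi> *v i w = w" for w
  proof -
    have "?p * ((?p * w $ 1 + ?q * w $ 2) / N) - ?q * ((?p * w $ 2 - ?q * w $ 1) / N) = w $ 1 * N / N"
      "?q * ((?p * w $ 1 + ?q * w $ 2) / N) + ?p * ((?p * w $ 2 - ?q * w $ 1) / N) = w $ 2 * N / N"
      by (simp_all add: N_def add_divide_distrib diff_divide_distrib algebra_simps)
    then show ?thesis using N by (simp add: i_def vec2_eq_iff)
  qed
  have perp\<phi>: "perp p \<bullet> (?\<phi> *v z) = N * z $ 2" for z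
    by (simp add: perp_inner matrix_vector_mult_def sum_2 N_def algebra_simps)
  have lin: "linear ((*v) ?\<phi>)" by (rule matrix_vector_mul_linear)
  have det: "?p * ?p - (- ?q) * ?q \<noteq> 0" using N unfolding N_def by auto
  then have inj: "inj ((*v) ?\<phi>)"
    using invertible_det_nz[of ?\<phi>] by (simp add: inj_matrix_vector_mult)
  let ?S = "{vc a 0, vc (- c) 0, i u, i v}"
  have ends: "?\<phi> *v vc a 0 = a *\<^sub>R p" "?\<phi> *v vc (- c) 0 = - (c *\<^sub>R p)"
    by (simp_all add: vec2_eq_iff mult.commute)
  have im: "(*v) ?\<phi> ` ?S = {a *\<^sub>R p, - (c *\<^sub>R p), u, v}"
    using ends \<phi>i by simp
  have im2: "(*v) ?\<phi> ` {vc a 0, vc (- c) 0} = {a *\<^sub>R p, - (c *\<^sub>R p)}"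
    using ends by simp
  have hullim: "(*v) ?\<phi> ` (convex hull ?S) = ?P"
    using convex_hull_linear_image[OF lin, of ?S] im Peq by simp
  have hullim2: "(*v) ?\<phi> ` (convex hull {vc a 0, vc (- c) 0}) = convex hull {a *\<^sub>R p, - (c *\<^sub>R p)}"
    using convex_hull_linear_image[OF lin, of "{vc a 0, vc (- c) 0}"] im2 by simp
  have iuv: "i u $ 2 > 0" "i v $ 2 < 0"
    using u v N by (simp_all add: i_def perp_inner divide_neg_pos)
  have "compatible a c (i u) (i v)"
    unfolding compatible_def
  proof (intro conjI iuv subset_antisym subsetI)
    fix z assume z: "z \<in> convex hull ?S \<inter> {x. x $ 2 = 0}"
    then have "?\<phi> *v z \<in> ?P \<inter> {x. perp p \<bullet> x = 0}" using hullim perp\<phi> by auto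
    then have "?\<phi> *v z \<in> (*v) ?\<phi> ` (convex hull {vc a 0, vc (- c) 0})" using line hullim2 by simp
    then show "z \<in> convex hull {vc a 0, vc (- c) 0}" using inj by (metis inj_image_mem_iff)
  next
    fix z assume z: "z \<in> convex hull {vc a 0, vc (- c) 0}"
    then have "?\<phi> *v z \<in> ?P \<inter> {x. perp p \<bullet> x = 0}" using line hullim2 by blast
    then have "?\<phi> *v z \<in> (*v) ?\<phi> ` (convex hull ?S)" "N * z $ 2 = 0" using hullim perp\<phi> by auto
    then show "z \<in> convex hull ?S \<inter> {x. x $ 2 = 0}" using inj N by (auto simp: inj_image_mem_iff)
  qed
  then have "\<nu> (convex hull ?S) = 0" using F_zero ac by blast
  moreover have "convex hull ?S \<in> polygons_o"
    using kite_in_polygons_o ac iuv by blast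
  ultimately show ?thesis
    using transform[of ?S ?p ?p "- ?q" ?q] det im Peq by (simp add: mat22_eq_iff congruence_mat2_nth)
qed

end

section \<open>From kites to arbitrary polygons\<close>

text \<open>Points of \<open>V\<close> on the cutting line are absorbed by \<open>E\<close>, so a
  piece keeps only the points strictly on its side. This makes counting points a usable induction
  measure.\<close>

lemma convex_hull_halfspace_ge_Un:
  fixes n :: "'a::real_inner"
  assumes h: "convex hull V \<inter> {x. n \<bullet> x = s} = convex hull E"
  shows "convex hull (convex hull V \<inter> {x. s \<le> n \<bullet> x} \<union> B) = convex hull ({x \<in> V. s < n \<bullet> x} \<union> E \<union> B)" (is "_ = ?R")
proof -
  let ?A = "V \<inter> {x. s \<le> n \<bullet> x}"
  have "convex hull (convex hull V \<inter> {x. s \<le> n \<bullet> x} \<union> B) = convex hull (?A \<union> convex hull E \<union> B)"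
    using convex_hull_Int_halfspace_ge[of V s n] convex_hull_convex_hull_Un[of "?A \<union> convex hull E" B] h by simp
  also have "\<dots> = ?R"
  proof
    have E: "convex hull E \<subseteq> ?R" by (intro hull_mono) auto
    have "x \<in> ?R" if "x \<in> ?A" for x
    proof (cases "n \<bullet> x = s")
      case True
      then have "x \<in> convex hull E" using h that hull_inc[of x V convex] by blast
      then show ?thesis using E by blast
    qed (use that in \<open>auto intro!: hull_inc\<close>)
    then show "convex hull (?A \<union> convex hull E \<union> B) \<subseteq> ?R"
      using E by (intro hull_minimal convex_convex_hull) (auto intro: hull_inc)
    have "E \<subseteq> convex hull E" by (rule hull_subset)
    then show "?R \<subseteq> convex hull (?A \<union> convex hull E \<union> B)"
      by (intro hull_mono) auto
  qed
  finally show ?thesis .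
qed

lemma convex_hull_halfspace_le_Un:
  fixes n :: "'a::real_inner"
  assumes h: "convex hull V \<inter> {x. n \<bullet> x = s} = convex hull E"
  shows "convex hull (convex hull V \<inter> {x. n \<bullet> x \<le> s} \<union> B) = convex hull ({x \<in> V. n \<bullet> x < s} \<union> E \<union> B)"
  using convex_hull_halfspace_ge_Un[of V "-n" "-s" E B] h by simp

lemma perp_antisym: "perp x \<bullet> y = - (perp y \<bullet> x)"
  by (simp add: perp_inner)

lemma perp_self [simp]: "perp x \<bullet> x = 0"
  by (simp add: perp_inner)

lemma perp_uminus [simp]: "perp (- x) = - perp x"
  by (simp add: vec2_eq_iff perp_def)

lemma perp_scaleR [simp]: "perp (t *\<^sub>R x) = t *\<^sub>R perp x"
  by (simp add: vec2_eq_iff perp_def)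

lemma perp_basis:
  assumes "perp a \<bullet> y \<noteq> 0"
  obtains s t where "z = s *\<^sub>R a + t *\<^sub>R y"
proof
  let ?D = "a $ 1 * y $ 2 - a $ 2 * y $ 1"
  have D: "?D \<noteq> 0" using assms by (simp add: perp_inner)
  let ?s = "(z $ 1 * y $ 2 - z $ 2 * y $ 1) / ?D" and ?t = "(a $ 1 * z $ 2 - a $ 2 * z $ 1) / ?D"
  have "?D * z $ 1 = (z $ 1 * y $ 2 - z $ 2 * y $ 1) * a $ 1 + (a $ 1 * z $ 2 - a $ 2 * z $ 1) * y $ 1"
    "?D * z $ 2 = (z $ 1 * y $ 2 - z $ 2 * y $ 1) * a $ 2 + (a $ 1 * z $ 2 - a $ 2 * z $ 1) * y $ 2"
    by (simp_all add: algebra_simps)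
  then have "z $ 1 = ?s * a $ 1 + ?t * y $ 1" "z $ 2 = ?s * a $ 2 + ?t * y $ 2"
    using D by (simp_all add: add_divide_distrib[symmetric] nonzero_eq_divide_eq mult.commute)
  then show "z = ?s *\<^sub>R a + ?t *\<^sub>R y" by (simp add: vec2_eq_iff)
qed

text \<open>The witness is the sum of the two functionals dual to the basis \<open>a\<close>,
  \<open>y\<close>.\<close>

lemma line_functional:
  assumes "perp a \<bullet> y \<noteq> 0"
  obtains m where "m \<bullet> a = 1" "m \<bullet> y = 1"
proof
  have ne: "perp y \<bullet> a \<noteq> 0" using assms perp_antisym[of y a] by simp
  let ?m = "(1 / (perp y \<bullet> a)) *\<^sub>R perp y + (1 / (perp a \<bullet> y)) *\<^sub>R perp a"
  show "?m \<bullet> a = 1" "?m \<bullet> y = 1"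
    using assms ne by (simp_all add: inner_add_left)
qed

lemma crossing_in_polygons_o:
  assumes "d \<noteq> 0" "a > 0" "b > 0" "perp d \<bullet> u > 0" "perp d \<bullet> v < 0"
  shows "convex hull {u, v, a *\<^sub>R d, - (b *\<^sub>R d)} \<in> polygons_o"
proof -
  have "\<exists>x\<in>{u, v, a *\<^sub>R d, - (b *\<^sub>R d)}. 0 < n \<bullet> x" if n: "n \<noteq> 0" for n :: "real^2"
  proof -
    consider "n \<bullet> d > 0" | "n \<bullet> d < 0" | "n \<bullet> d = 0" by linarith
    then show ?thesis
    proof cases
      case 3
      have "perp (perp d) = - d" by (simp add: vec2_eq_iff perp_def)
      then have "perp (perp d) \<bullet> n = 0" using 3 by (simp add: inner_commute)
      then obtain t where t: "n = t *\<^sub>R perp d"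
        using perp_inner_eq_0_iff[of "perp d" n] assms by auto
      have "t \<noteq> 0" using n t by auto
      then show ?thesis using t assms by (cases "t > 0") (auto simp: mult_neg_neg)
    qed (use assms in \<open>auto simp: mult_pos_neg\<close>)
  qed
  then show ?thesis by (simp add: polygons_o_convex_hull_iff)
qed

context null_valuation
begin

text \<open>The correction term of \<open>cut\<close> is the kite spanned by the section and the
  points \<open>u\<close> and \<open>v\<close>, which has value 0. These points may be taken
  anywhere in the polygon, not only among its vertices.\<close>

lemma cut_line:
  assumes V: "finite V" "convex hull V \<in> polygons_o" and d: "d \<noteq> 0" and ab: "a > 0" "b > 0"
    and line: "convex hull V \<inter> {x. perp d \<bullet> x = 0} = convex hull {a *\<^sub>R d, - (b *\<^sub>R d)}"
    and u: "u \<in> convex hull V" "perp d \<bullet> u > 0" and v: "v \<in> convex hull V" "perp d \<bullet> v < 0"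
  defines "E \<equiv> {a *\<^sub>R d, - (b *\<^sub>R d)}"
  defines "K \<equiv> convex hull ({x \<in> V. perp d \<bullet> x > 0} \<union> E \<union> {v})"
  defines "L \<equiv> convex hull ({x \<in> V. perp d \<bullet> x < 0} \<union> E \<union> {u})"
  shows "K \<in> polygons_o" "L \<in> polygons_o" "\<nu> (convex hull V) = \<nu> K + \<nu> L"
proof -
  let ?P = "convex hull V"
  let ?M = "convex hull {u, v, a *\<^sub>R d, - (b *\<^sub>R d)}"
  have line': "?P \<inter> {x. perp d \<bullet> x = 0} = convex hull E" using line by (simp add: E_def)
  have po: "?M \<in> polygons_o" using crossing_in_polygons_o d ab u v by blast
  have M: "convex hull (?P \<inter> {x. perp d \<bullet> x = 0} \<union> {u} \<union> {v}) = ?M"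
    unfolding line Un_assoc convex_hull_convex_hull_Un by (simp add: insert_commute)
  have M0: "\<nu> ?M = 0"
    using po d u v by (intro kite_zero[of _ _ _ d]) auto
  have K: "convex hull (?P \<inter> {x. 0 \<le> perp d \<bullet> x} \<union> {v}) = K"
    unfolding K_def by (rule convex_hull_halfspace_ge_Un[OF line'])
  have L: "convex hull (?P \<inter> {x. perp d \<bullet> x \<le> 0} \<union> {u}) = L"
    unfolding L_def by (rule convex_hull_halfspace_le_Un[OF line'])
  show "\<nu> ?P = \<nu> K + \<nu> L"
    using cut[OF V(2), of "{u}" 0 "perp d" "{v}"] u v po M0 unfolding M K L by simp
  have uK: "u \<in> K" using K u hull_inc[of u "?P \<inter> {x. 0 \<le> perp d \<bullet> x} \<union> {v}" convex] by auto
  have vL: "v \<in> L" using L v hull_inc[of v "?P \<inter> {x. perp d \<bullet> x \<le> 0} \<union> {u}" convex] by auto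
  have "?M \<subseteq> K"
    by (rule hull_minimal) (use uK in \<open>auto simp: K_def E_def intro: hull_inc\<close>)
  then show "K \<in> polygons_o" unfolding K_def
    by (rule polygons_o_superset[rotated 2]) (use V po in \<open>auto simp: E_def\<close>)
  have "?M \<subseteq> L"
    by (rule hull_minimal) (use vL in \<open>auto simp: L_def E_def intro: hull_inc\<close>)
  then show "L \<in> polygons_o" unfolding L_def
    by (rule polygons_o_superset[rotated 2]) (use V po in \<open>auto simp: E_def\<close>)
qed

text \<open>If all five points are vertices, the line through \<open>a\<close> and \<open>y\<close> (which misses the origin)
  splits the pentagon into kites; \<open>m\<close> and \<open>m'\<close> are the supporting functionals along the edges
  \<open>a x\<close> and \<open>x y\<close>.\<close>

lemma pentagon_zero:
  assumes P: "convex hull {x, y, a, b, - (e *\<^sub>R x)} \<in> polygons_o"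
    and ab: "a = \<alpha> *\<^sub>R d" "b = - (\<beta> *\<^sub>R d)" "\<alpha> > 0" "\<beta> > 0" and e: "e > 0"
    and d: "d \<noteq> 0" "perp d \<bullet> x > 0" "perp d \<bullet> y > 0" and xy: "perp x \<bullet> y > 0"
  shows "\<nu> (convex hull {x, y, a, b, - (e *\<^sub>R x)}) = 0"
proof -
  let ?v = "- (e *\<^sub>R x)"
  let ?P = "convex hull {x, y, a, b, ?v}"
  have 0: "0 \<in> convex hull {a, b}"
  proof -
    have "0 = (1 - \<alpha> / (\<alpha> + \<beta>)) *\<^sub>R a + (\<alpha> / (\<alpha> + \<beta>)) *\<^sub>R b"
      unfolding ab using ab by (simp add: vec2_eq_iff field_simps)
    moreover have "0 \<le> \<alpha> / (\<alpha> + \<beta>)" "\<alpha> / (\<alpha> + \<beta>) \<le> 1" using ab by auto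
    ultimately show ?thesis
      unfolding segment_convex_hull[symmetric] in_segment by blast
  qed
  have x0: "x \<noteq> 0" using d by auto
  have pv: "perp d \<bullet> ?v < 0" using d e by simp
  have pE: "perp d \<bullet> z = 0" if "z \<in> {a, b}" for z using that ab by auto
  show ?thesis
  proof (cases "x \<in> convex hull {y, ?v, a, b} \<or> y \<in> convex hull {x, ?v, a, b}")
    case True
    then consider "x \<in> convex hull {y, ?v, a, b}" | "y \<in> convex hull {x, ?v, a, b}" by blast
    then show ?thesis
    proof cases
      case 1
      then have "?P = convex hull {y, ?v, a, b}"
        using hull_redundant[of x convex "{y, ?v, a, b}"] by (simp add: insert_commute)
      then show ?thesis using kite_zero[of y ?v "{a, b}" d] P d pv pE by simp
    next
      case 2
      then have "?P = convex hull {x, ?v, a, b}"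
        using hull_redundant[of y convex "{x, ?v, a, b}"] by (simp add: insert_commute)
      then show ?thesis using kite_zero[of x ?v "{a, b}" d] P d pv pE by simp
    qed
  next
    case False
    have in3: "s *\<^sub>R p + t *\<^sub>R q \<in> convex hull {p, ?v, a, b}"
      if "s \<ge> 0" "t \<ge> 0" "s + t \<le> 1" "q \<in> {a, b}" for s t p q
    proof -
      let ?H = "convex hull {p, ?v, a, b}"
      have "0 \<in> ?H" using 0 hull_mono[of "{a, b}" "{p, ?v, a, b}" convex] by auto
      moreover have "p \<in> ?H" "q \<in> ?H" using that by (auto intro: hull_inc)
      moreover have "convex hull {0, p, q} \<subseteq> ?H"
        using calculation by (intro hull_minimal convex_convex_hull) auto
      moreover have "s *\<^sub>R p + t *\<^sub>R q \<in> convex hull {0, p, q}"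
        unfolding convex_hull_3 using that
        by (intro CollectI exI[of _ "1 - s - t"] exI[of _ s] exI[of _ t]) auto
      ultimately show ?thesis by blast
    qed
    have ay: "perp a \<bullet> y > 0" using ab d by simp
    have ax: "perp a \<bullet> x > 0" using ab d by simp
    obtain \<mu> l where x: "x = \<mu> *\<^sub>R y + l *\<^sub>R a"
      using perp_basis[of a y x] ay by (metis add.commute less_irrefl)
    have mu: "\<mu> > 0"
    proof -
      have "perp a \<bullet> x = \<mu> * (perp a \<bullet> y)" unfolding x by (simp add: inner_add_right)
      then show ?thesis using ax ay by (metis zero_less_mult_pos2)
    qed
    have l: "l > 0"
    proof -
      have "perp y \<bullet> x = l * (perp y \<bullet> a)" unfolding x by (simp add: inner_add_right)
      then have "perp x \<bullet> y = l * (perp a \<bullet> y)" using perp_antisym[of y x] perp_antisym[of y a] by simp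
      then show ?thesis using xy ay by (metis zero_less_mult_pos2)
    qed
    \<comment> \<open>Otherwise \<open>x\<close> would lie in the triangle with vertices 0,
      \<open>y\<close>, \<open>a\<close> and be redundant. So \<open>x\<close> lies strictly beyond
      the line through \<open>a\<close> and \<open>y\<close>; \<open>c2\<close> treats
      \<open>y\<close> in the same way.\<close>
    have c1: "\<mu> + l > 1"
      using in3[of \<mu> l a y] False mu l x by force
    have y: "y = (1 / \<mu>) *\<^sub>R x + (l * \<alpha> / (\<mu> * \<beta>)) *\<^sub>R b"
    proof -
      have "(l * \<alpha> / (\<mu> * \<beta>)) *\<^sub>R b = (- (l / \<mu>)) *\<^sub>R a"
        using ab by simp
      then show ?thesis using mu unfolding x by (simp add: scaleR_add_right)
    qed
    have c2: "1 / \<mu> + l * \<alpha> / (\<mu> * \<beta>) > 1"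
    proof (rule ccontr)
      assume "\<not> ?thesis"
      then have "y \<in> convex hull {x, ?v, a, b}"
        using in3[of "1 / \<mu>" "l * \<alpha> / (\<mu> * \<beta>)" b x] mu l ab y by auto
      then show False using False by blast
    qed
    have bt: "f \<bullet> b = - (\<beta> / \<alpha>) * (f \<bullet> a)" for f using ab by simp
    \<comment> \<open>\<open>c2\<close> cleared of denominators; it keeps \<open>b\<close> on the
      inner side of the line through \<open>x\<close> and \<open>y\<close>.\<close>
    have c2': "(\<mu> - 1) * \<beta> < l * \<alpha>"
    proof -
      have "\<mu> * \<beta> < (1 / \<mu> + l * \<alpha> / (\<mu> * \<beta>)) * (\<mu> * \<beta>)"
        using c2 mu ab by (metis mult_less_cancel_right_pos mult_1 mult_pos_pos)
      also have "\<dots> = \<beta> + l * \<alpha>" using mu ab by (simp add: field_simps)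
      finally show ?thesis by (simp add: algebra_simps)
    qed
    obtain n where n: "n \<bullet> a = 1" "n \<bullet> y = 1" using line_functional[of a y] ay by auto
    obtain m where m: "m \<bullet> a = 1" "m \<bullet> x = 1" using line_functional[of a x] ax by auto
    obtain m' where m': "m' \<bullet> x = 1" "m' \<bullet> y = 1" using line_functional[of x y] xy by auto
    have nx: "n \<bullet> x > 1" using n c1 unfolding x by (simp add: inner_add_right)
    have nb: "n \<bullet> b < 0" using bt[of n] n(1) ab(3,4) by simp
    have nv: "n \<bullet> ?v < 0" using nx e by simp
    have my: "m \<bullet> y < 1"
    proof -
      have "1 = \<mu> * (m \<bullet> y) + l" using m x by (metis inner_add_right inner_scaleR_right mult.right_neutral)
      then have "\<mu> * (m \<bullet> y) < \<mu> * 1" using c1 by simp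
      then show ?thesis using mu by (metis mult_less_cancel_left_pos)
    qed
    have m'a_eq: "1 = \<mu> + l * (m' \<bullet> a)"
      using m' x by (metis inner_add_right inner_scaleR_right mult.right_neutral)
    have m'a: "m' \<bullet> a < 1"
    proof -
      have "l * (m' \<bullet> a) < l * 1" using m'a_eq c1 by simp
      then show ?thesis using l by (metis mult_less_cancel_left_pos)
    qed
    have m'b: "m' \<bullet> b \<le> 1"
    proof -
      have "(l * \<alpha>) * (m' \<bullet> b) = - \<beta> * (l * (m' \<bullet> a))" using bt[of m'] ab(3,4) by simp
      also have "\<dots> = (\<mu> - 1) * \<beta>" proof -
        have "l * (m' \<bullet> a) = 1 - \<mu>" using m'a_eq by simp
        then show ?thesis by (simp only:) (simp add: algebra_simps)
      qed
      finally have "(l * \<alpha>) * (m' \<bullet> b) < (l * \<alpha>) * 1" using c2' by simp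
      then show ?thesis using l ab(3) by (metis less_eq_real_def mult_less_cancel_left_pos mult_pos_pos)
    qed
    have mb: "m \<bullet> b < 0" using bt[of m] m(1) ab(3,4) by simp
    have Pm: "?P \<subseteq> {z. m \<bullet> z \<le> 1}"
      by (intro hull_minimal convex_halfspace_le) (use m my mb e in auto)
    have Pm': "?P \<subseteq> {z. m' \<bullet> z \<le> 1}"
      by (intro hull_minimal convex_halfspace_le) (use m' m'a m'b e in auto)
    \<comment> \<open>A point of the line is an affine combination of \<open>a\<close> and
      \<open>y\<close>. The bound from \<open>m\<close> makes the weight of \<open>y\<close>
      nonnegative, the bound from \<open>m'\<close> that of \<open>a\<close>.\<close>
    have h: "?P \<inter> {z. n \<bullet> z = 1} = convex hull {a, y}"
    proof
      have "convex hull {a, y} \<subseteq> {z. n \<bullet> z = 1}"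
        using n by (intro hull_minimal convex_hyperplane) auto
      moreover have "convex hull {a, y} \<subseteq> ?P" by (intro hull_mono) auto
      ultimately show "convex hull {a, y} \<subseteq> ?P \<inter> {z. n \<bullet> z = 1}" by blast
      show "?P \<inter> {z. n \<bullet> z = 1} \<subseteq> convex hull {a, y}"
      proof
        fix z assume z: "z \<in> ?P \<inter> {z. n \<bullet> z = 1}"
        obtain s t where st: "z = s *\<^sub>R a + t *\<^sub>R y" using perp_basis[of a y z] ay by auto
        have s: "s = 1 - t" using z n unfolding st by (simp add: inner_add_right)
        have "m \<bullet> z \<le> 1" using z Pm by blast
        then have "t * (1 - m \<bullet> y) \<ge> 0" using m unfolding st s by (simp add: inner_add_right algebra_simps)
        then have "t \<ge> 0" using my by (simp add: zero_le_mult_iff)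
        have "m' \<bullet> z \<le> 1" using z Pm' by blast
        moreover have "m' \<bullet> z = s * (m' \<bullet> a) + t" unfolding st using m' by (simp add: inner_add_right)
        ultimately have "s * (1 - m' \<bullet> a) \<ge> 0" using s by (simp add: right_diff_distrib)
        then have "s \<ge> 0" using m'a by (simp add: zero_le_mult_iff)
        then show "z \<in> convex hull {a, y}"
          unfolding segment_convex_hull[symmetric] in_segment using st s \<open>t \<ge> 0\<close> by auto
      qed
    qed
    have xa: "perp x \<bullet> a < 0" using ax perp_antisym[of x a] by simp
    \<comment> \<open>\<open>x\<close> is a positive combination of \<open>y\<close> and
      \<open>a\<close>, so the origin is a positive combination of \<open>y\<close>,
      \<open>a\<close> and \<open>?v\<close>.\<close>
    have poM: "convex hull {y, a, ?v} \<in> polygons_o"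
    proof -
      have "\<exists>z\<in>{y, a, ?v}. 0 < f \<bullet> z" if f: "f \<noteq> 0" for f
      proof (rule ccontr)
        assume "\<not> ?thesis"
        then have neg: "f \<bullet> y \<le> 0" "f \<bullet> a \<le> 0" "f \<bullet> ?v \<le> 0" by auto
        then have "f \<bullet> x \<ge> 0" using e by (simp add: zero_le_mult_iff)
        moreover have fx: "f \<bullet> x = \<mu> * (f \<bullet> y) + l * (f \<bullet> a)" unfolding x by (simp add: inner_add_right)
        moreover have "\<mu> * (f \<bullet> y) \<le> 0" "l * (f \<bullet> a) \<le> 0" using neg mu l by (simp_all add: mult_le_0_iff)
        ultimately have "\<mu> * (f \<bullet> y) = 0" "l * (f \<bullet> a) = 0" by linarith+
        then have f0: "f \<bullet> y = 0" "f \<bullet> a = 0" using mu l by auto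
        obtain s t where "f = s *\<^sub>R a + t *\<^sub>R y" using perp_basis[of a y f] ay by auto
        then have "f \<bullet> f = 0" using f0 by (metis add.right_neutral inner_add_right inner_scaleR_right mult_zero_right)
        then show False using f by simp
      qed
      then show ?thesis by (simp add: polygons_o_convex_hull_iff)
    qed
    \<comment> \<open>The origin is on the side of \<open>?v\<close>, so only the piece containing
      \<open>x\<close> needs an added point. As \<open>?v\<close> is opposite to \<open>x\<close>,
      the piece \<open>K\<close> and the intersection are kites along the line of \<open>x\<close>;
      the piece \<open>L\<close> is a kite along \<open>d\<close>.\<close>
    have M: "convex hull (?P \<inter> {z. n \<bullet> z = 1} \<union> {} \<union> {?v}) = convex hull {y, a, ?v}"
      unfolding h Un_empty_right convex_hull_convex_hull_Un by (simp add: insert_commute)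
    have "{z \<in> {x, y, a, b, ?v}. 1 < n \<bullet> z} = {x}" using nx nb nv n by auto
    then have K: "convex hull (?P \<inter> {z. 1 \<le> n \<bullet> z} \<union> {?v}) = convex hull {y, a, x, ?v}"
      using convex_hull_halfspace_ge_Un[OF h, of "{?v}"] by (simp add: insert_commute)
    have "{z \<in> {x, y, a, b, ?v}. n \<bullet> z < 1} = {b, ?v}" using nx nb nv n by auto
    then have L: "convex hull (?P \<inter> {z. n \<bullet> z \<le> 1} \<union> {}) = convex hull {y, ?v, a, b}"
      using convex_hull_halfspace_le_Un[OF h, of "{}"] by (simp add: insert_commute)
    have poK: "convex hull {y, a, x, ?v} \<in> polygons_o" "convex hull {y, ?v, a, b} \<in> polygons_o"
      by (auto intro!: polygons_o_superset[OF _ poM] hull_mono)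
    have "\<nu> (convex hull {y, a, ?v}) = 0" "\<nu> (convex hull {y, a, x, ?v}) = 0"
      using poM poK x0 xy xa by (auto intro!: kite_zero[of _ _ _ x])
    moreover have "\<nu> (convex hull {y, ?v, a, b}) = 0"
      using poK d pv pE by (intro kite_zero[of _ _ _ d]) auto
    moreover have "?v \<in> ?P" by (rule hull_inc) simp
    ultimately show ?thesis
      using cut[OF P, of "{}" 1 n "{?v}"] poM nv unfolding M K L by simp
  qed
qed

text \<open>Induction on the number of points of \<open>W\<close>: the lower vertex \<open>v\<close> may be moved to a point opposite
  to some \<open>w \<in> W\<close>, and cutting along the line of \<open>w\<close> leaves fewer points on each side, unless
  \<open>W\<close> consists of just two directions.\<close>

lemma half_zero:
  assumes "d \<noteq> 0" "finite W" "W \<noteq> {}" "\<And>x. x \<in> W \<Longrightarrow> perp d \<bullet> x > 0" "perp d \<bullet> v < 0"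
    and "finite E" "\<And>x. x \<in> E \<Longrightarrow> perp d \<bullet> x = 0"
    and "convex hull (W \<union> E \<union> {v}) \<in> polygons_o"
  shows "\<nu> (convex hull (W \<union> E \<union> {v})) = 0"
  using assms
proof (induction "card W" arbitrary: d W v E rule: less_induct)
  case less
  note d = less.prems(1) and W = less.prems(2-4) and v = less.prems(5) and E = less.prems(6,7) and P = less.prems(8)
  let ?V = "W \<union> E \<union> {v}"
  let ?P = "convex hull ?V"
  obtain \<alpha> \<beta> where ab: "\<alpha> > 0" "\<beta> > 0"
    and line: "?P \<inter> {x. perp d \<bullet> x = 0} = convex hull {\<alpha> *\<^sub>R d, - (\<beta> *\<^sub>R d)}"
    using polygons_o_Int_line[OF P d] by blast
  define a b where "a = \<alpha> *\<^sub>R d" and "b = - (\<beta> *\<^sub>R d)"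
  have pa: "perp d \<bullet> a = 0" "perp d \<bullet> b = 0" by (simp_all add: a_def b_def)
  have pwa: "perp w \<bullet> a < 0" "perp w \<bullet> b > 0" if "w \<in> W" for w
    using W(3)[OF that] ab perp_antisym[of w d] by (simp_all add: a_def b_def)
  have Vpos: "{x \<in> ?V. perp d \<bullet> x > 0} = W" and Vneg: "{x \<in> ?V. perp d \<bullet> x < 0} = {v}"
    using W(3) v E(2) by force+
  \<comment> \<open>Cut along \<open>d\<close> itself, adding \<open>v'\<close> to the upper half
    and \<open>u\<close> to the lower one: the lower piece has a single vertex on each side and is a
    kite.\<close>
  have move: "convex hull (W \<union> {a, b} \<union> {v'}) \<in> polygons_o \<and> \<nu> ?P = \<nu> (convex hull (W \<union> {a, b} \<union> {v'}))"
    if v': "v' \<in> ?P" "perp d \<bullet> v' < 0" for v'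
  proof -
    obtain u where u: "u \<in> W" using W(2) by blast
    then have uP: "u \<in> ?P" by (auto intro: hull_inc)
    note c = cut_line[OF _ P d ab line uP W(3)[OF u] v', unfolded Vpos Vneg, folded a_def b_def]
    have "\<nu> (convex hull ({v} \<union> {a, b} \<union> {u})) = 0"
      using kite_zero[of u v "{a, b}" d] c(2) W E d u v pa by (auto simp: insert_commute)
    then show ?thesis using c(1,3) W(1) E(1) by simp
  qed
  have small: "\<exists>e>0. - (e *\<^sub>R w) \<in> ?P" for w
    using polygons_o_small_multiple[OF P, of "- w"] by auto
  \<comment> \<open>Cutting along \<open>w\<close> adds one of \<open>a\<close>, \<open>b\<close> to
    the points on each side, hence the strict gap of one in both assumptions. The other of the two
    becomes the lower vertex of the piece.\<close>
  have middle: ?case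
    if w: "w \<in> W" and c1: "card {x \<in> W. perp w \<bullet> x > 0} + 1 < card W"
      and c2: "card {x \<in> W. perp w \<bullet> x < 0} + 1 < card W" for w
  proof -
    obtain e where e: "e > 0" "- (e *\<^sub>R w) \<in> ?P" using small by blast
    have wd: "perp d \<bullet> - (e *\<^sub>R w) < 0" using W(3)[OF w] e by simp
    let ?V' = "W \<union> {a, b} \<union> {- (e *\<^sub>R w)}"
    have P': "convex hull ?V' \<in> polygons_o" and eq: "\<nu> ?P = \<nu> (convex hull ?V')"
      using move[OF e(2) wd] by auto
    have w0: "w \<noteq> 0" using W(3)[OF w] by auto
    obtain \<alpha>' \<beta>' where ab': "\<alpha>' > 0" "\<beta>' > 0"
      and line': "convex hull ?V' \<inter> {x. perp w \<bullet> x = 0} = convex hull {\<alpha>' *\<^sub>R w, - (\<beta>' *\<^sub>R w)}"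
      using polygons_o_Int_line[OF P' w0] by blast
    have fin: "finite ?V'" using W by simp
    have mem: "b \<in> convex hull ?V'" "a \<in> convex hull ?V'" by (auto intro: hull_inc)
    have pos: "{x \<in> ?V'. perp w \<bullet> x > 0} = insert b {x \<in> W. perp w \<bullet> x > 0}"
      and neg: "{x \<in> ?V'. perp w \<bullet> x < 0} = insert a {x \<in> W. perp w \<bullet> x < 0}"
      using pwa[OF w] by auto
    let ?E = "{\<alpha>' *\<^sub>R w, - (\<beta>' *\<^sub>R w)}"
    note c = cut_line[OF fin P' w0 ab' line' mem(1) pwa(2)[OF w] mem(2) pwa(1)[OF w], unfolded pos neg]
    have "card (insert b {x \<in> W. perp w \<bullet> x > 0}) \<le> card {x \<in> W. perp w \<bullet> x > 0} + 1"
      "card (insert a {x \<in> W. perp w \<bullet> x < 0}) \<le> card {x \<in> W. perp w \<bullet> x < 0} + 1"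
      using W(1) by (simp_all add: card_insert_if)
    then have small_card: "card (insert b {x \<in> W. perp w \<bullet> x > 0}) < card W"
      "card (insert a {x \<in> W. perp w \<bullet> x < 0}) < card W"
      using c1 c2 by linarith+
    have "\<nu> (convex hull (insert b {x \<in> W. perp w \<bullet> x > 0} \<union> ?E \<union> {a})) = 0"
      by (rule less.hyps[OF small_card(1) w0]) (use W(1) pwa[OF w] c(1) in auto)
    moreover have "\<nu> (convex hull (insert a {x \<in> W. perp w \<bullet> x < 0} \<union> ?E \<union> {b})) = 0"
      \<comment> \<open>This piece lies on the negative side of \<open>w\<close>, so the induction
        hypothesis is used for the direction \<open>- w\<close>.\<close>
      by (rule less.hyps[OF small_card(2), of "- w"]) (use W(1) pwa[OF w] c(2) w0 in auto)
    ultimately show ?case using eq c(3) by simp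
  qed
  show ?case
  proof (cases "card W = 1")
    case True
    then obtain u where u: "W = {u}" by (auto simp: card_1_singleton_iff)
    have "?V = insert u (insert v E)" using u by auto
    then show ?thesis using kite_zero[of u v E d] P d v E W(3) u by simp
  next
    case False
    \<comment> \<open>The cotangent of the angle from \<open>d\<close>, which orders
      \<open>W\<close> by direction; \<open>p\<close> and \<open>q\<close> below are extreme
      directions.\<close>
    define f where "f x = (d \<bullet> x) / (perp d \<bullet> x)" for x
    have cross: "perp x \<bullet> y > 0 \<longleftrightarrow> f x > f y" if "x \<in> W" "y \<in> W" for x y
    proof -
      have "(d \<bullet> d) * (perp x \<bullet> y) = (d \<bullet> x) * (perp d \<bullet> y) - (d \<bullet> y) * (perp d \<bullet> x)"
        unfolding perp_inner by (simp add: inner_real2 algebra_simps)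
      then have "perp x \<bullet> y > 0 \<longleftrightarrow> (d \<bullet> x) * (perp d \<bullet> y) - (d \<bullet> y) * (perp d \<bullet> x) > 0"
        using d by (metis inner_gt_zero_iff zero_less_mult_pos mult_pos_pos)
      also have "\<dots> \<longleftrightarrow> f x > f y"
        using W(3)[OF that(1)] W(3)[OF that(2)] by (simp add: f_def field_simps)
      finally show ?thesis .
    qed
    have cross': "perp x \<bullet> y < 0 \<longleftrightarrow> f x < f y" if "x \<in> W" "y \<in> W" for x y
      using cross[OF that(2,1)] perp_antisym[of x y] by simp
    obtain p where p: "p \<in> W" "\<And>x. x \<in> W \<Longrightarrow> f x \<le> f p"
      using obtains_MAX[OF W(1,2), of f] W(1) by (metis Max_ge finite_imageI imageI)
    obtain q where q: "q \<in> W" "\<And>x. x \<in> W \<Longrightarrow> f q \<le> f x"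
      using obtains_MIN[OF W(1,2), of f] W(1) by (metis Min_le finite_imageI imageI)
    show ?thesis
    proof (cases "W \<subseteq> {p, q}")
      case False
      then obtain w where w: "w \<in> W" "w \<noteq> p" "w \<noteq> q" by blast
      \<comment> \<open>A point \<open>w\<close> other than \<open>p\<close> and \<open>q\<close>
        qualifies for \<open>middle\<close>: neither side contains \<open>w\<close>, and each side
        misses one of the two extreme points.\<close>
      have two: "card S + 1 < card W" if "S \<subseteq> W - {w, r}" "r \<in> W" "r \<noteq> w" for S r
      proof -
        have "card S \<le> card (W - {w, r})" using that W(1) by (intro card_mono) auto
        also have "\<dots> = card W - 2" using that w W(1) by (subst card_Diff_subset) auto
        finally show ?thesis using card_mono[of W "{w, r}"] that w W(1) by simp
      qed
      have sub: "{x \<in> W. perp w \<bullet> x > 0} \<subseteq> W - {w, p}" "{x \<in> W. perp w \<bullet> x < 0} \<subseteq> W - {w, q}"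
        using cross[OF w(1)] cross'[OF w(1)] p(2)[OF w(1)] q(2)[OF w(1)] by (auto simp: not_less)
      show ?thesis
        by (rule middle[OF w(1) two[OF sub(1) p(1)] two[OF sub(2) q(1)]]) (use w in auto)
    next
      case True
      then have Wpq: "W = {p, q}" using p q by auto
      then have pq: "p \<noteq> q" using \<open>card W \<noteq> 1\<close> by auto
      show ?thesis
      proof (cases "perp p \<bullet> q > 0")
        case True
        obtain e where e: "e > 0" "- (e *\<^sub>R p) \<in> ?P" using small by blast
        have pd: "perp d \<bullet> - (e *\<^sub>R p) < 0" using W(3)[OF p(1)] e by simp
        have "W \<union> {a, b} \<union> {- (e *\<^sub>R p)} = {p, q, a, b, - (e *\<^sub>R p)}" using Wpq by auto
        then show ?thesis
          using move[OF e(2) pd] pentagon_zero[of p q a b e \<alpha> d \<beta>] a_def b_def ab e d W(3) p(1) q(1) True by simp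
      next
        case False
        \<comment> \<open>Two points on the same ray: cutting along it leaves no point of
          \<open>W\<close> on either side.\<close>
        then have "f p = f q" using cross[OF p(1) q(1)] p(2)[OF q(1)] by simp
        then have "f x = f p" if "x \<in> W" for x using that Wpq by auto
        then have "{x \<in> W. perp p \<bullet> x > 0} = {}" "{x \<in> W. perp p \<bullet> x < 0} = {}"
          using cross[OF p(1)] cross'[OF p(1)] by auto
        then show ?thesis using middle[OF p(1)] Wpq pq by simp
      qed
    qed
  qed
qed

text \<open>One cut along the horizontal axis, closing each half with a single vertex of the other,
  produces two polygons of the shape treated by \<open>half_zero\<close>; the lower one is read with
  the direction reversed.\<close>

theorem null_valuation_zero:
  assumes P: "P \<in> polygons_o"
  shows "\<nu> P = 0"
proof -
  obtain V where V: "finite V" "P = convex hull V" using polygons_oE[OF P] .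
  let ?d = "vc 1 0"
  have d: "?d \<noteq> 0" by (simp add: zero_vc)
  obtain a b where ab: "a > 0" "b > 0"
    and line: "convex hull V \<inter> {x. perp ?d \<bullet> x = 0} = convex hull {a *\<^sub>R ?d, - (b *\<^sub>R ?d)}"
    using polygons_o_Int_line[OF P d] V by blast
  obtain u where u: "u \<in> V" "perp ?d \<bullet> u > 0"
    using P V d polygons_o_convex_hull_iff[of V] by (metis perp_eq_0_iff)
  obtain v where v: "v \<in> V" "- perp ?d \<bullet> v > 0"
    using P V d polygons_o_convex_hull_iff[of V] by (metis perp_eq_0_iff neg_equal_0_iff_equal)
  have uv: "u \<in> convex hull V" "v \<in> convex hull V" using u v by (auto intro: hull_inc)
  have v': "perp ?d \<bullet> v < 0" using v by simp
  note c = cut_line[OF V(1) P[unfolded V(2)] d ab line uv(1) u(2) uv(2) v']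
  have "\<nu> (convex hull ({x \<in> V. perp ?d \<bullet> x > 0} \<union> {a *\<^sub>R ?d, - (b *\<^sub>R ?d)} \<union> {v})) = 0"
    by (rule half_zero[OF d]) (use V u v' c(1) in \<open>auto simp del: scaleR_vc uminus_vc inner_vc\<close>)
  moreover have "\<nu> (convex hull ({x \<in> V. perp ?d \<bullet> x < 0} \<union> {a *\<^sub>R ?d, - (b *\<^sub>R ?d)} \<union> {u})) = 0"
    by (rule half_zero[of "- ?d"]) (use V d u v v' c(2) in \<open>auto simp del: scaleR_vc uminus_vc inner_vc\<close>)
  ultimately show ?thesis using c(3) V(2) by simp
qed

end

section \<open>The moment matrix\<close>

lemma absolutely_integrable_on_compact:
  fixes f :: "'a::euclidean_space \<Rightarrow> 'b::euclidean_space"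
  assumes "compact S" "continuous_on S f"
  shows "f absolutely_integrable_on S"
  using borel_integrable_compact[OF assms] integrable_completion[OF borel_measurable_integrable]
  unfolding set_integrable_def by blast

lemma polygons_o_compact: "P \<in> polygons_o \<Longrightarrow> compact P"
  by (simp add: polygons_o_def polytope_imp_compact)

lemma moment_integrable:
  assumes "P \<in> polygons_o"
  shows "(\<lambda>x. x $ i * x $ j) integrable_on P"
  using assms
  by (intro set_lebesgue_integral_eq_integral(1) absolutely_integrable_on_compact polygons_o_compact)
    (auto intro!: continuous_intros)

lemma integral_Un_Int:
  fixes f :: "'a::euclidean_space \<Rightarrow> 'b::euclidean_space"
  assumes "f integrable_on K" "f integrable_on L" "f integrable_on (K \<union> L)" "f integrable_on (K \<inter> L)"
  shows "integral (K \<union> L) f + integral (K \<inter> L) f = integral K f + integral L f"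
proof -
  let ?g = "\<lambda>S x. if x \<in> S then f x else 0"
  have I: "?g S integrable_on UNIV" if "f integrable_on S" for S
    using that by (simp add: integrable_restrict_UNIV)
  have "(\<lambda>x. ?g (K \<union> L) x + ?g (K \<inter> L) x) = (\<lambda>x. ?g K x + ?g L x)" by auto
  then have "integral UNIV (\<lambda>x. ?g (K \<union> L) x + ?g (K \<inter> L) x) = integral UNIV (\<lambda>x. ?g K x + ?g L x)"
    by simp
  then show ?thesis
    using assms I
    by (simp only: Henstock_Kurzweil_Integration.integral_add Henstock_Kurzweil_Integration.integral_restrict_UNIV)
qed

lemma moment_matrix_valuation: "valuation_on polygons_o moment_matrix"
  unfolding valuation_on_def
proof (intro allI impI)
  fix K L assume "K \<in> polygons_o" "L \<in> polygons_o" "K \<union> L \<in> polygons_o" "K \<inter> L \<in> polygons_o"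
  then show "moment_matrix (K \<union> L) + moment_matrix (K \<inter> L) = moment_matrix K + moment_matrix L"
    by (simp add: moment_matrix_def vec_eq_iff integral_Un_Int moment_integrable)
qed

lemma moment_matrix_covariant: "GL2_covariant moment_matrix"
  unfolding GL2_covariant_def
proof (intro ballI allI impI)
  fix P and \<phi> :: "real^2^2"
  assume P: "P \<in> polygons_o" and "invertible \<phi>"
  let ?I = "\<lambda>k l. integral P (\<lambda>x. x $ k * x $ l)"
  have "integral ((*v) \<phi> ` P) (\<lambda>x. x $ i * x $ j) =
      \<bar>det \<phi>\<bar> * (\<phi> $ i $ 1 * \<phi> $ j $ 1 * ?I 1 1 + \<phi> $ i $ 1 * \<phi> $ j $ 2 * ?I 1 2 +
        \<phi> $ i $ 2 * \<phi> $ j $ 1 * ?I 2 1 + \<phi> $ i $ 2 * \<phi> $ j $ 2 * ?I 2 2)" for i j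
  proof -
    \<comment> \<open>For fixed \<open>i\<close> all moments are components of this vector-valued
      map; the variables are changed once and component \<open>j\<close> is read off
      afterwards.\<close>
    let ?f = "\<lambda>x::real^2. x $ i *\<^sub>R x"
    have c: "continuous_on S ((*v) \<phi>)" for S
      by (intro linear_continuous_on matrix_vector_mul_bounded_linear)
    have im: "?f absolutely_integrable_on ((*v) \<phi> ` P)"
      using polygons_o_compact[OF P] c
      by (intro absolutely_integrable_on_compact compact_continuous_image) (auto intro!: continuous_intros)
    have pre: "(?f \<circ> (*v) \<phi>) absolutely_integrable_on P"
      unfolding o_def using polygons_o_compact[OF P] c
      by (intro absolutely_integrable_on_compact) (auto intro!: continuous_intros)
    have "integral ((*v) \<phi> ` P) ?f = \<bar>det \<phi>\<bar> *\<^sub>R integral P (?f \<circ> (*v) \<phi>)"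
      using integral_change_of_variables_linear[where g = "(*v) \<phi>" and f = ?f and S = P] im by simp
    then have "integral ((*v) \<phi> ` P) ?f $ j = \<bar>det \<phi>\<bar> * (integral P (?f \<circ> (*v) \<phi>) $ j)"
      by simp
    moreover have "integral ((*v) \<phi> ` P) ?f $ j = integral ((*v) \<phi> ` P) (\<lambda>x. x $ i * x $ j)"
      using integral_component_eq_cart[OF set_lebesgue_integral_eq_integral(1)[OF im], of j] by simp
    moreover have "integral P (?f \<circ> (*v) \<phi>) $ j = integral P (\<lambda>x. (\<phi> *v x) $ i * (\<phi> *v x) $ j)"
      using integral_component_eq_cart[OF set_lebesgue_integral_eq_integral(1)[OF pre], of j] by (simp add: o_def)
    moreover have "integral P (\<lambda>x. (\<phi> *v x) $ i * (\<phi> *v x) $ j) =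
        integral P (\<lambda>x. \<phi> $ i $ 1 * \<phi> $ j $ 1 * (x $ 1 * x $ 1) + \<phi> $ i $ 1 * \<phi> $ j $ 2 * (x $ 1 * x $ 2) +
          \<phi> $ i $ 2 * \<phi> $ j $ 1 * (x $ 2 * x $ 1) + \<phi> $ i $ 2 * \<phi> $ j $ 2 * (x $ 2 * x $ 2))"
      by (rule arg_cong[where f = "integral P"]) (auto simp: matrix_vector_mult_def sum_2 algebra_simps)
    ultimately show ?thesis
      using P by (simp add: Henstock_Kurzweil_Integration.integral_add integrable_add moment_integrable
          Henstock_Kurzweil_Integration.integral_mult_right integrable_on_mult_right)
  qed
  then show "moment_matrix ((*v) \<phi> ` P) = \<bar>det \<phi>\<bar> *\<^sub>R (\<phi> ** moment_matrix P ** transpose \<phi>)"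
    by (simp add: moment_matrix_def vec_eq_iff matrix_matrix_mult_def transpose_def sum_2 algebra_simps)
qed

lemma moment_matrix_11_pos:
  assumes P: "P \<in> polygons_o"
  shows "moment_matrix P $ 1 $ 1 > 0"
proof -
  let ?f = "\<lambda>x::real^2. x $ 1 * x $ 1"
  obtain e where e: "e > 0" "cball 0 e \<subseteq> P"
    using P by (auto simp: polygons_o_def mem_interior_cball)
  \<comment> \<open>The square with coordinates between \<open>r\<close> and \<open>2 * r\<close>
    fits into the ball of radius \<open>4 * r = e\<close>, and on it the integrand is at least
    \<open>r * r\<close>.\<close>
  define r where "r = e / 4"
  have r: "r > 0" using e by (simp add: r_def)
  let ?B = "cbox (vc r r) (vc (2 * r) (2 * r))"
  have B: "?B \<subseteq> P"
  proof
    fix x assume x: "x \<in> ?B"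
    then have "norm x \<le> \<bar>x $ 1\<bar> + \<bar>x $ 2\<bar>"
      using norm_le_l1_cart[of x] by (simp add: sum_2)
    also have "\<dots> \<le> 2 * r + 2 * r"
      using x r by (auto simp: mem_box_cart forall_2 intro!: add_mono)
    also have "\<dots> = e" by (simp add: r_def)
    finally show "x \<in> P" using e by auto
  qed
  have intB: "?f integrable_on ?B" by (intro integrable_continuous continuous_intros)
  have "vc r r $ i < vc (2 * r) (2 * r) $ i" for i
    using r exhaust_2[of i] by auto
  then have "0 < measure lborel ?B"
    unfolding content_pos_lt_eq by (auto simp: Basis_vec_def inner_axis simp del: inner_vc)
  then have "0 < r * r * measure lborel ?B"
    using r by simp
  also have "\<dots> = integral ?B (\<lambda>x. r * r)" by simp
  also have "\<dots> \<le> integral ?B ?f"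
    using intB r by (intro integral_le) (auto simp: mem_box_cart forall_2 intro!: mult_mono)
  also have "\<dots> \<le> integral P ?f"
    using B intB moment_integrable[OF P] by (intro integral_subset_le) auto
  finally show ?thesis by (simp add: moment_matrix_def)
qed

theorem theorem3p12:
  fixes \<mu> :: "(real^2) set \<Rightarrow> real^2^2"
  assumes "measurable_on_polygons \<mu>"
    and "valuation_on polygons_o \<mu>"
    and "GL2_covariant \<mu>"
  shows "\<exists>k::real. \<forall>P \<in> polygons_o. \<mu> P = k *\<^sub>R moment_matrix P"
proof -
  let ?Q = "double_pyramid 1 1 1 1"
  have Q: "moment_matrix ?Q $ 1 $ 1 > 0"
    by (intro moment_matrix_11_pos double_pyramid_in_polygons_o) auto
  define k where "k = \<mu> ?Q $ 1 $ 1 / moment_matrix ?Q $ 1 $ 1"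
  define \<nu> where "\<nu> P = \<mu> P - k *\<^sub>R moment_matrix P" for P
  interpret null_valuation \<nu>
  proof
    show "valuation_on polygons_o \<nu>"
      unfolding valuation_on_def
    proof (intro allI impI)
      fix K L assume "K \<in> polygons_o" "L \<in> polygons_o" "K \<union> L \<in> polygons_o" "K \<inter> L \<in> polygons_o"
      then have "\<mu> (K \<union> L) + \<mu> (K \<inter> L) = \<mu> K + \<mu> L"
        "moment_matrix (K \<union> L) + moment_matrix (K \<inter> L) = moment_matrix K + moment_matrix L"
        using assms(2) moment_matrix_valuation unfolding valuation_on_def by blast+
      then have "(\<mu> (K \<union> L) + \<mu> (K \<inter> L)) - k *\<^sub>R (moment_matrix (K \<union> L) + moment_matrix (K \<inter> L)) =
          (\<mu> K + \<mu> L) - k *\<^sub>R (moment_matrix K + moment_matrix L)" by simp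
      then show "\<nu> (K \<union> L) + \<nu> (K \<inter> L) = \<nu> K + \<nu> L"
        unfolding \<nu>_def by (simp add: algebra_simps)
    qed
    show "GL2_covariant \<nu>"
      unfolding GL2_covariant_def
    proof (intro ballI allI impI)
      fix P and \<phi> :: "real^2^2" assume "P \<in> polygons_o" "invertible \<phi>"
      then have "\<mu> ((*v) \<phi> ` P) = \<bar>det \<phi>\<bar> *\<^sub>R (\<phi> ** \<mu> P ** transpose \<phi>)"
        "moment_matrix ((*v) \<phi> ` P) = \<bar>det \<phi>\<bar> *\<^sub>R (\<phi> ** moment_matrix P ** transpose \<phi>)"
        using assms(3) moment_matrix_covariant unfolding GL2_covariant_def by blast+
      then show "\<nu> ((*v) \<phi> ` P) = \<bar>det \<phi>\<bar> *\<^sub>R (\<phi> ** \<nu> P ** transpose \<phi>)"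
        unfolding \<nu>_def by (simp add: vec_eq_iff matrix_matrix_mult_def transpose_def sum_2 algebra_simps)
    qed
    show "\<nu> ?Q $ 1 $ 1 = 0" using Q by (simp add: \<nu>_def k_def)
  qed
  have "\<mu> P = k *\<^sub>R moment_matrix P" if "P \<in> polygons_o" for P
    using null_valuation_zero[OF that] by (simp add: \<nu>_def)
  then show ?thesis by blast
qed

end
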